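(* For every framed link $L$ in $S^3$, the Gromov norm $|Z_L|\in\mathbb Q[[1/x]]$ of the framed Kontsevich integral $Z_L$ of $L$ is Gevrey-0, i.e. it is a convergent power series for $x$ near $\infty$.
   Context: **Gevrey.** A series $\sum_{n\ge0}a_nx^{-n}\in\mathbb C[[1/x]]$ is Gevrey-$s$ if there is $C>0$ with $|a_n|\le C^n\,n!^s$ for all $n>0$. **Jacobi diagrams.** An open Jacobi diagram is a finite graph with univalent vertices (legs) and trivalent vertices, with a cyclic ordering of the edges at each trivalent vertex; its degree is half its number of vertices. For a compact oriented 1-manifold $X$ and a finite set $Y$, a Jacobi diagram based on $X\cup Y$ is $X\cup\Gamma$, with $\Gamma$ an open Jacobi diagram some of whose legs are labeled by elements of $Y$ (repetitions allowed) and whose other legs are glued to distinct interior points of $X$; its degree is that of $\Gamma$. $\mathcal A(X,Y)$ is the completion with respect to degree of the $\mathbb Q$-vector space spanned by these diagrams modulo AS (reversing the cyclic order at one vertex changes the sign), IHX ($I=H-X$) and STU ($S=T-U$, for two adjacent legs on $X$). For $L$ with $m$ components, $Z_L$ lies in $\mathcal A(\circlearrowleft_m)=\mathcal A(X,\emptyset)$ with $X$ the union of $m$ numbered oriented circles. $\mathcal A(\star_1)=\mathcal A(\emptyset,\{1\})$, with product the disjoint union $\sqcup$; $\mathcal A(\uparrow_1)$ is the case of $X$ one interval, $Y=\emptyset$; the symmetrization isomorphism $\chi:\mathcal A(\star_1)\to\mathcal A(\uparrow_1)$ averages over all ways to attach the legs to the interval. **Gromov norm.** If $b$ spans a vector space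 $V$, put $|v|_b=\inf\sum_j|c_j|$ over all finite presentations $v=\sum_jc_jv_j$ with $v_j\in b$. For $v\in\mathcal A(X,Y)$ with degree-$n$ part $\mathrm{Grad}_n(v)$, $|v|=\sum_{n\ge0}|\mathrm{Grad}_n(v)|\,x^{-n}$, the norms on the right being taken with respect to the set of Jacobi diagrams based on $X\cup Y$. **Kontsevich integral.** Let $w_{2n}\in\mathcal A(\star_1)$ be the wheel: a circle with $2n$ legs attached. Put $\sqrt\nu=\exp_\sqcup(\frac12\sum_{n\ge1}b_{2n}w_{2n})$, where $\sum_{n\ge0} b_{2n}t^{2n}=\frac12\log\frac{\sinh(t/2)}{t/2}$. The framed Kontsevich integral $Z_T\in\mathcal A(T,\emptyset)$ (coefficients extended to $\mathbb C$) is the standard Le–Murakami/Bar-Natan invariant of parenthesized framed oriented tangles determined by: multiplicativity under composition and juxtaposition; each local maximum or minimum gives $\chi(\sqrt\nu)$ on the strand; a positive (negative) crossing gives $\exp(\pm\frac12\,\text{chord between the two strands})$ followed by the transposition of strands; the elementary change of parenthesization on three strands gives the KZ associator $\Phi^{\mathrm{KZ}}(A,B)=1+\frac1{24}[A,B]-\frac{\zeta(3)}{(2\pi i)^3}[A,[A,B]]+\cdots$, where $A$ (resp. $B$) is the chord joining strands 1,2 (resp. 2,3); and compatibility with cabling and orientation reversal. Here $\Phi^{\mathrm{KZ}}=G_1^{-1}G_0$, where $G_0,G_1$ solve $G'(z)=\frac1{2\pi i}(\frac Az+\frac B{z-1})G(z)$ on $(0,1)$ with $G_0\sim z^{A/2\pi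 i}$ as $z\to0$ and $G_1\sim(1-z)^{B/2\pi i}$ as $z\to1$. For a framed link $L$ (a tangle without boundary points), $Z_L$ is known to have rational coefficients. *)

theory Defs
  imports
    "HOL-Analysis.Analysis"
    "HOL-Computational_Algebra.Formal_Power_Series"
    "HOL-Combinatorics.Permutations"
    "HOL-Library.Poly_Mapping"
    "HOL-Library.Multiset"
begin

section \<open>Gevrey series\<close>

definition gevrey :: "real \<Rightarrow> (nat \<Rightarrow> 'a::real_normed_vector) \<Rightarrow> bool" where
  "gevrey s a \<longleftrightarrow> (\<exists>C>0. \<forall>n>0. norm (a n) \<le> C ^ n * fact n powr s)"


section \<open>Jacobi diagrams\<close>

text \<open>
  Components of a one-manifold. \<open>Arc p q\<close> is an interval oriented from its end point \<open>p\<close> to its end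
  point \<open>q\<close>. \<open>Bot i\<close> and \<open>Top i\<close> are the \<open>i\<close>-th bottom and top boundary points of a tangle, counted
  from the left, starting with 0; \<open>Mid i\<close> occurs only while two tangles are being composed.
  A one-manifold is a list of numbered components.
\<close>

datatype point = Bot nat | Mid nat | Top nat
datatype strand = Arc point point | Circ

text \<open>
  A diagram is given by its incidences. Edges have names. A trivalent vertex is the triple of its
  incident edges in their cyclic order; the entry \<open>(k, ls)\<close> of \<open>comps\<close> is a component of the
  one-manifold with the edges of the legs glued to it, listed along its orientation (up to rotation
  if \<open>k = Circ\<close>); the entry \<open>(y, e)\<close> of \<open>labs\<close> is a leg with edge \<open>e\<close> and label \<open>y\<close>. An edge has two
  ends, so every edge name has to occur exactly twice (twice at the same vertex for a loop).
\<close>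

datatype 'e jgraph = JD (verts: "('e \<times> 'e \<times> 'e) list") (comps: "(strand \<times> 'e list) list")
  (labs: "(nat \<times> 'e) list")

type_synonym jdiag = "nat jgraph"

definition edge_ends :: "jdiag \<Rightarrow> nat list" where
  "edge_ends D = concat (map (\<lambda>(a, b, c). [a, b, c]) (verts D))
     @ concat (map snd (comps D)) @ map snd (labs D)"

definition jdiags :: "strand list \<Rightarrow> nat set \<Rightarrow> jdiag set" where
  "jdiags X Y = {D. (\<forall>e\<in>set (edge_ends D). count_list (edge_ends D) e = 2)
     \<and> map fst (comps D) = X \<and> fst ` set (labs D) \<subseteq> Y}"

definition legs_no :: "jdiag \<Rightarrow> nat" where
  "legs_no D = length (concat (map snd (comps D))) + length (labs D)"

text \<open>The number of vertices of a diagram is even, being congruent to the number of edge ends.\<close>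

definition jdegree :: "jdiag \<Rightarrow> nat" where
  "jdegree D = (length (verts D) + legs_no D) div 2"

definition cyc :: "'e \<times> 'e \<times> 'e \<Rightarrow> ('e \<times> 'e \<times> 'e) set" where
  "cyc v = (case v of (a, b, c) \<Rightarrow> {(a, b, c), (b, c, a), (c, a, b)})"

definition same_legs :: "strand \<times> nat list \<Rightarrow> strand \<times> nat list \<Rightarrow> bool" where
  "same_legs p q \<longleftrightarrow> fst p = fst q
     \<and> (snd p = snd q \<or> fst p = Circ \<and> (\<exists>r. snd q = rotate r (snd p)))"

definition jiso :: "jdiag \<Rightarrow> jdiag \<Rightarrow> bool" where
  "jiso D E \<longleftrightarrow> (\<exists>f. inj f
     \<and> mset (map cyc (verts (map_jgraph f D))) = mset (map cyc (verts E))
     \<and> list_all2 same_legs (comps (map_jgraph f D)) (comps E)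
     \<and> mset (labs (map_jgraph f D)) = mset (labs E))"


section \<open>The spaces of Jacobi diagrams and the Gromov norm\<close>

type_synonym chain = "jdiag \<Rightarrow>\<^sub>0 complex"

definition cscale :: "complex \<Rightarrow> chain \<Rightarrow> chain" where
  "cscale a p = Poly_Mapping.map ((*) a) p"

text \<open>
  The vertices are read counterclockwise from planar pictures, with the strand in STU running from
  left to right below the vertex. In IHX, \<open>a\<close>, \<open>b\<close>, \<open>c\<close>, \<open>d\<close> are the ends at the upper left, upper
  right, lower left and lower right and \<open>e\<close> is the inner edge.
\<close>

inductive_set jrel :: "strand list \<Rightarrow> nat set \<Rightarrow> chain set" for X :: "strand list" and Y :: "nat set"
where
  ISO: "\<lbrakk>D \<in> jdiags X Y; E \<in> jdiags X Y; jiso D E\<rbrakk>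
    \<Longrightarrow> Poly_Mapping.single D 1 - Poly_Mapping.single E 1 \<in> jrel X Y"
| AS: "JD ((a, b, c) # vs) cs ls \<in> jdiags X Y
    \<Longrightarrow> Poly_Mapping.single (JD ((a, b, c) # vs) cs ls) 1
      + Poly_Mapping.single (JD ((b, a, c) # vs) cs ls) 1 \<in> jrel X Y"
| IHX: "JD ((b, a, e) # (e, c, d) # vs) cs ls \<in> jdiags X Y
    \<Longrightarrow> Poly_Mapping.single (JD ((b, a, e) # (e, c, d) # vs) cs ls) 1
      - (Poly_Mapping.single (JD ((e, a, c) # (b, e, d) # vs) cs ls) 1
         - Poly_Mapping.single (JD ((c, b, e) # (e, a, d) # vs) cs ls) 1) \<in> jrel X Y"
| STU: "JD ((c, b, a) # vs) (cs @ (k, us @ [c] @ ws) # cs') ls \<in> jdiags X Y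
    \<Longrightarrow> Poly_Mapping.single (JD ((c, b, a) # vs) (cs @ (k, us @ [c] @ ws) # cs') ls) 1
      - (Poly_Mapping.single (JD vs (cs @ (k, us @ [a, b] @ ws) # cs') ls) 1
         - Poly_Mapping.single (JD vs (cs @ (k, us @ [b, a] @ ws) # cs') ls) 1) \<in> jrel X Y"

text \<open>
  For a subfield \<open>K\<close> of the complex numbers (\<open>\<rat>\<close> or \<open>UNIV\<close> below), \<open>jchains K X Y\<close> is the \<open>K\<close>-vector
  space with basis the diagrams based on \<open>X\<close> and \<open>Y\<close>, and its quotient by \<open>jspan K X Y\<close> is the
  space \<open>A(X,Y)\<close> with coefficients in \<open>K\<close>, before completion. An element of the completion is
  represented by a sequence of chains, the \<open>n\<close>-th one being homogeneous of degree \<open>n\<close>.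
\<close>

definition jchains :: "complex set \<Rightarrow> strand list \<Rightarrow> nat set \<Rightarrow> chain set" where
  "jchains K X Y = {c. range (Poly_Mapping.lookup c) \<subseteq> K \<and> Poly_Mapping.keys c \<subseteq> jdiags X Y}"

definition jspan :: "complex set \<Rightarrow> strand list \<Rightarrow> nat set \<Rightarrow> chain set" where
  "jspan K X Y = {\<Sum>r\<in>R. cscale (a r) r |R a. finite R \<and> R \<subseteq> jrel X Y \<and> a ` R \<subseteq> K}"

definition homogeneous :: "nat \<Rightarrow> chain \<Rightarrow> bool" where
  "homogeneous n c \<longleftrightarrow> (\<forall>D\<in>Poly_Mapping.keys c. jdegree D = n)"

definition gromov_norm ::
  "complex set \<Rightarrow> strand list \<Rightarrow> nat set \<Rightarrow> (nat \<Rightarrow> chain) \<Rightarrow> nat \<Rightarrow> real" where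
  "gromov_norm K X Y z n =
     Inf {\<Sum>D\<in>Poly_Mapping.keys c. norm (Poly_Mapping.lookup c D) |c.
            c \<in> jchains K X Y \<and> z n - c \<in> jspan K X Y}"


section \<open>Operations on chains\<close>

definition linext :: "(jdiag \<Rightarrow> chain) \<Rightarrow> chain \<Rightarrow> chain" where
  "linext f p = (\<Sum>D\<in>Poly_Mapping.keys p. cscale (Poly_Mapping.lookup p D) (f D))"

definition bilin :: "(jdiag \<Rightarrow> jdiag \<Rightarrow> jdiag) \<Rightarrow> chain \<Rightarrow> chain \<Rightarrow> chain" where
  "bilin f p q = linext (\<lambda>D. linext (\<lambda>E. Poly_Mapping.single (f D E) 1) q) p"

definition graded_prod ::
  "(jdiag \<Rightarrow> jdiag \<Rightarrow> jdiag) \<Rightarrow> (nat \<Rightarrow> chain) \<Rightarrow> (nat \<Rightarrow> chain) \<Rightarrow> nat \<Rightarrow> chain" where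
  "graded_prod f z z' n = (\<Sum>i\<le>n. bilin f (z i) (z' (n - i)))"

definition in_degree0 :: "jdiag \<Rightarrow> nat \<Rightarrow> chain" where
  "in_degree0 D n = (if n = 0 then Poly_Mapping.single D 1 else 0)"

text \<open>
  \<open>\<Sum>k. a k \<cdot> z^k\<close> for the product \<open>f\<close> with unit \<open>D\<close> and a series \<open>z\<close> without term of degree 0, so
  that only \<open>k \<le> n\<close> contribute in degree \<open>n\<close>.
\<close>

definition power_sum ::
  "(jdiag \<Rightarrow> jdiag \<Rightarrow> jdiag) \<Rightarrow> jdiag \<Rightarrow> (nat \<Rightarrow> complex) \<Rightarrow> (nat \<Rightarrow> chain) \<Rightarrow> nat \<Rightarrow> chain" where
  "power_sum f D a z n = (\<Sum>k\<le>n. cscale (a k) ((graded_prod f z ^^ k) (in_degree0 D) n))"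

definition edge_bound :: "jdiag \<Rightarrow> nat" where
  "edge_bound D = Suc (Max (insert 0 (set (edge_ends D))))"

definition shift_edges :: "jdiag \<Rightarrow> jdiag \<Rightarrow> jdiag" where
  "shift_edges D E = map_jgraph (\<lambda>e. edge_bound D + e) E"

definition disj_union :: "jdiag \<Rightarrow> jdiag \<Rightarrow> jdiag" where
  "disj_union D E = (let E' = shift_edges D E in
     JD (verts D @ verts E') (comps D @ comps E') (labs D @ labs E'))"

fun map_point :: "(point \<Rightarrow> point) \<Rightarrow> strand \<Rightarrow> strand" where
  "map_point f (Arc p q) = Arc (f p) (f q)"
| "map_point f Circ = Circ"

definition map_points :: "(point \<Rightarrow> point) \<Rightarrow> jdiag \<Rightarrow> jdiag" where
  "map_points f D = JD (verts D) (map (\<lambda>(k, ls). (map_point f k, ls)) (comps D)) (labs D)"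

text \<open>\<open>juxtapose a b D E\<close> puts \<open>E\<close> to the right of \<open>D\<close>, which has \<open>a\<close> bottom and \<open>b\<close> top points.\<close>

fun shift_point :: "nat \<Rightarrow> nat \<Rightarrow> point \<Rightarrow> point" where
  "shift_point a b (Bot i) = Bot (a + i)"
| "shift_point a b (Top i) = Top (b + i)"
| "shift_point a b (Mid i) = Mid i"

definition juxtapose :: "nat \<Rightarrow> nat \<Rightarrow> jdiag \<Rightarrow> jdiag \<Rightarrow> jdiag" where
  "juxtapose a b D E = disj_union D (map_points (shift_point a b) E)"

text \<open>\<open>glue p\<close> joins the arc that ends at \<open>p\<close> to the arc that starts at \<open>p\<close>.\<close>

fun starts_at :: "point \<Rightarrow> strand \<Rightarrow> bool" where
  "starts_at p (Arc a b) = (a = p)"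
| "starts_at p Circ = False"

fun ends_at :: "point \<Rightarrow> strand \<Rightarrow> bool" where
  "ends_at p (Arc a b) = (b = p)"
| "ends_at p Circ = False"

definition glue :: "point \<Rightarrow> (strand \<times> nat list) list \<Rightarrow> (strand \<times> nat list) list" where
  "glue p cs =
     (let rest = filter (\<lambda>(k, _). \<not> starts_at p k \<and> \<not> ends_at p k) cs in
      case (filter (\<lambda>(k, _). ends_at p k) cs, filter (\<lambda>(k, _). starts_at p k) cs) of
        ([(Arc a _, ls)], [(Arc _ b, ms)]) \<Rightarrow>
          (if a = p then (Circ, ls) # rest else (Arc a b, ls @ ms) # rest)
      | _ \<Rightarrow> cs)"

fun top_to_mid :: "point \<Rightarrow> point" where
  "top_to_mid (Top i) = Mid i"
| "top_to_mid p = p"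

fun bot_to_mid :: "point \<Rightarrow> point" where
  "bot_to_mid (Bot i) = Mid i"
| "bot_to_mid p = p"

text \<open>\<open>stack n D E\<close> puts \<open>E\<close> on top of \<open>D\<close>, along \<open>n\<close> common boundary points.\<close>

definition stack :: "nat \<Rightarrow> jdiag \<Rightarrow> jdiag \<Rightarrow> jdiag" where
  "stack n D E = (let F = disj_union (map_points top_to_mid D) (map_points bot_to_mid E) in
     JD (verts F) (fold (\<lambda>i. glue (Mid i)) [0..<n] (comps F)) (labs F))"


section \<open>The series at the extrema\<close>

text \<open>The wheel with \<open>k\<close> legs, all labelled 1; the legs are the edges \<open>0..<k\<close>.\<close>

definition wheel :: "nat \<Rightarrow> jdiag" where
  "wheel k = JD (map (\<lambda>i. (i, k + i, k + (i + k - 1) mod k)) [0..<k]) [] (map (\<lambda>i. (1, i)) [0..<k])"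

definition b_series :: "complex fps" where
  "b_series = fps_const (1/2) *
     fps_compose (fps_ln 1) ((fps_exp (1/2) - fps_exp (- 1/2)) / fps_X - 1)"

text \<open>\<open>wheels_exp r\<close> is the exponential of \<open>r \<cdot> (\<Sum>n\<ge>1. b\<^sub>2\<^sub>n w\<^sub>2\<^sub>n)\<close> for disjoint union;
  the degree of \<open>w\<^sub>2\<^sub>n\<close> is \<open>2n\<close>.\<close>

definition wheels_exp :: "complex \<Rightarrow> nat \<Rightarrow> chain" where
  "wheels_exp r = power_sum disj_union (JD [] [] []) (\<lambda>k. 1 / fact k)
     (\<lambda>n. if even n \<and> n > 0 then Poly_Mapping.single (wheel n) (r * fps_nth b_series n) else 0)"

text \<open>Symmetrization, with values on the interval from \<open>Bot 0\<close> to \<open>Top 0\<close>.\<close>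

definition chi_diag :: "jdiag \<Rightarrow> chain" where
  "chi_diag D = (\<Sum>\<sigma> | \<sigma> permutes {..<length (labs D)}.
     Poly_Mapping.single
       (JD (verts D) [(Arc (Bot 0) (Top 0), permute_list \<sigma> (map snd (labs D)))] [])
       (1 / fact (length (labs D))))"

definition chi :: "(nat \<Rightarrow> chain) \<Rightarrow> nat \<Rightarrow> chain" where
  "chi z n = linext chi_diag (z n)"

text \<open>
  The value of the invariant on an extremum is a square root of \<open>\<nu> = chi (wheels_exp 1)\<close>. The
  square root of the exponential with respect to disjoint union, mapped to the interval by \<open>chi\<close>, is
  \<open>sqrt_nu_union\<close>. Since \<open>chi\<close> is not multiplicative, this differs, from degree 4 on, from the square
  root of \<open>\<nu>\<close> for the product of the interval algebra (binomial series), which is \<open>sqrt_nu_stack\<close>;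
  the latter gives the invariance under straightening a strand with a maximum and a minimum.
\<close>

definition sqrt_nu_union :: "nat \<Rightarrow> chain" where
  "sqrt_nu_union = chi (wheels_exp (1/2))"

definition sqrt_nu_stack :: "nat \<Rightarrow> chain" where
  "sqrt_nu_stack = power_sum (stack 1) (JD [] [(Arc (Bot 0) (Top 0), [])] [])
     (\<lambda>k. (1/2) gchoose k) (\<lambda>n. if n = 0 then 0 else chi (wheels_exp 1) n)"


section \<open>The KZ associator\<close>

text \<open>
  Noncommutative power series in \<open>A\<close> and \<open>B\<close> are given by their coefficients at the words in the two
  letters; \<open>True\<close> is \<open>A\<close> and \<open>False\<close> is \<open>B\<close>.
\<close>

type_synonym nc_series = "bool list \<Rightarrow> complex"

definition nc_mult :: "nc_series \<Rightarrow> nc_series \<Rightarrow> nc_series" where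
  "nc_mult f g w = (\<Sum>i\<le>length w. f (take i w) * g (drop i w))"

definition nc_one :: nc_series where
  "nc_one w = (if w = [] then 1 else 0)"

definition nc_letter :: "bool \<Rightarrow> nc_series" where
  "nc_letter l w = (if w = [l] then 1 else 0)"

text \<open>\<open>nc_exp l c\<close> is the exponential of \<open>c\<close> times the letter \<open>l\<close>.\<close>

definition nc_exp :: "bool \<Rightarrow> complex \<Rightarrow> nc_series" where
  "nc_exp l c w = (if set w \<subseteq> {l} then c ^ length w / fact (length w) else 0)"

definition nc_inverse :: "nc_series \<Rightarrow> nc_series" where
  "nc_inverse f = (THE g. nc_mult f g = nc_one \<and> nc_mult g f = nc_one)"

definition solves_KZ :: "(real \<Rightarrow> nc_series) \<Rightarrow> bool" where
  "solves_KZ G \<longleftrightarrow> (\<forall>z\<in>{0<..<1}. \<forall>w. ((\<lambda>t. G t w) has_vector_derivative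
     1 / (2 * of_real pi * \<i>) * (nc_mult (nc_letter True) (G z) w / of_real z
       + nc_mult (nc_letter False) (G z) w / of_real (z - 1))) (at z))"

text \<open>\<open>G\<^sub>0 \<sim> z\<^bsup>A/2\<pi>i\<^esup>\<close> means that \<open>G\<^sub>0 z\<^bsup>-A/2\<pi>i\<^esup>\<close> tends to 1 coefficientwise; similarly at 1.\<close>

definition asymp_at_0 :: "(real \<Rightarrow> nc_series) \<Rightarrow> bool" where
  "asymp_at_0 G \<longleftrightarrow> (\<forall>w. ((\<lambda>z. nc_mult (G z)
     (nc_exp True (- of_real (ln z) / (2 * of_real pi * \<i>))) w) \<longlongrightarrow> nc_one w) (at_right 0))"

definition asymp_at_1 :: "(real \<Rightarrow> nc_series) \<Rightarrow> bool" where
  "asymp_at_1 G \<longleftrightarrow> (\<forall>w. ((\<lambda>z. nc_mult (G z)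
     (nc_exp False (- of_real (ln (1 - z)) / (2 * of_real pi * \<i>))) w) \<longlongrightarrow> nc_one w) (at_left 1))"

definition KZ_associator :: nc_series where
  "KZ_associator = (THE \<Phi>. \<exists>G0 G1. solves_KZ G0 \<and> asymp_at_0 G0 \<and> solves_KZ G1 \<and> asymp_at_1 G1
     \<and> (\<forall>z\<in>{0<..<1}. \<Phi> = nc_mult (nc_inverse (G1 z)) (G0 z)))"


section \<open>Parenthesized framed oriented tangles\<close>

text \<open>
  Boundary words: the letter \<open>True\<close> is a strand directed upwards, \<open>False\<close> one directed downwards. The
  empty word is a strict unit for \<open>pjuxt\<close>.
\<close>

datatype pword = Emp | Letter bool | Pair pword pword

fun letters :: "pword \<Rightarrow> bool list" where
  "letters Emp = []"
| "letters (Letter b) = [b]"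
| "letters (Pair u v) = letters u @ letters v"

definition pjuxt :: "pword \<Rightarrow> pword \<Rightarrow> pword" where
  "pjuxt u v = (if u = Emp then v else if v = Emp then u else Pair u v)"

text \<open>
  Tangles are composed from elementary ones, read from bottom to top.
  \<open>Crossing r a b\<close> has the bottom letters \<open>a\<close> and \<open>b\<close>; the strand with letter \<open>a\<close>, running between
  lower left and upper right, is the upper one iff \<open>r\<close>. \<open>Minimum a\<close> has the top letters \<open>a\<close> and
  \<open>\<not> a\<close>, and \<open>Maximum a\<close> has these as bottom letters. \<open>Assoc u v w\<close> changes \<open>(u v) w\<close> at the bottom
  into \<open>u (v w)\<close> at the top, for cables \<open>u\<close>, \<open>v\<close>, \<open>w\<close>. \<open>Comp S T\<close> is \<open>T\<close> on top of \<open>S\<close>.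
\<close>

datatype tangle = Straight pword
  | Crossing bool bool bool | Minimum bool | Maximum bool
  | Assoc pword pword pword | AssocInv pword pword pword
  | Juxt tangle tangle | Comp tangle tangle

primrec bottom :: "tangle \<Rightarrow> pword" where
  "bottom (Straight u) = u"
| "bottom (Crossing r a b) = Pair (Letter a) (Letter b)"
| "bottom (Minimum a) = Emp"
| "bottom (Maximum a) = Pair (Letter a) (Letter (\<not> a))"
| "bottom (Assoc u v w) = pjuxt (pjuxt u v) w"
| "bottom (AssocInv u v w) = pjuxt u (pjuxt v w)"
| "bottom (Juxt S T) = pjuxt (bottom S) (bottom T)"
| "bottom (Comp S T) = bottom S"

primrec top_word :: "tangle \<Rightarrow> pword" where
  "top_word (Straight u) = u"
| "top_word (Crossing r a b) = Pair (Letter b) (Letter a)"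
| "top_word (Minimum a) = Pair (Letter a) (Letter (\<not> a))"
| "top_word (Maximum a) = Emp"
| "top_word (Assoc u v w) = pjuxt u (pjuxt v w)"
| "top_word (AssocInv u v w) = pjuxt (pjuxt u v) w"
| "top_word (Juxt S T) = pjuxt (top_word S) (top_word T)"
| "top_word (Comp S T) = top_word T"

primrec composable :: "tangle \<Rightarrow> bool" where
  "composable (Straight u) = True"
| "composable (Crossing r a b) = True"
| "composable (Minimum a) = True"
| "composable (Maximum a) = True"
| "composable (Assoc u v w) = True"
| "composable (AssocInv u v w) = True"
| "composable (Juxt S T) = (composable S \<and> composable T)"
| "composable (Comp S T) = (composable S \<and> composable T \<and> top_word S = bottom T)"

definition juxt_op :: "tangle \<Rightarrow> tangle \<Rightarrow> jdiag \<Rightarrow> jdiag \<Rightarrow> jdiag" where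
  "juxt_op S T = juxtapose (length (letters (bottom S))) (length (letters (top_word S)))"

definition comp_op :: "tangle \<Rightarrow> tangle \<Rightarrow> jdiag \<Rightarrow> jdiag \<Rightarrow> jdiag" where
  "comp_op S T = stack (length (letters (top_word S)))"

text \<open>
  \<open>chord_diag os \<pi> cs\<close>: strands with letters \<open>os\<close> from \<open>i\<close> at the bottom to \<open>\<pi> i\<close> at the top, with
  horizontal chords between the strands given by \<open>cs\<close>, listed from top to bottom.
\<close>

definition vstrand :: "bool \<Rightarrow> nat \<Rightarrow> nat \<Rightarrow> strand" where
  "vstrand b i j = (if b then Arc (Bot i) (Top j) else Arc (Top j) (Bot i))"

definition chord_diag :: "bool list \<Rightarrow> (nat \<Rightarrow> nat) \<Rightarrow> (nat \<times> nat) list \<Rightarrow> jdiag" where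
  "chord_diag os \<pi> cs = JD []
     (map (\<lambda>s. (vstrand (os ! s) s (\<pi> s),
        (if os ! s then rev else id)
          (filter (\<lambda>k. fst (cs ! k) = s \<or> snd (cs ! k) = s) [0..<length cs]))) [0..<length os]) []"

definition extremum_diag :: "strand \<Rightarrow> jdiag \<Rightarrow> jdiag" where
  "extremum_diag k D = JD (verts D) (map (\<lambda>(_, ls). (k, ls)) (comps D)) (labs D)"

definition min_strand :: "bool \<Rightarrow> strand" where
  "min_strand a = (if a then Arc (Top 1) (Top 0) else Arc (Top 0) (Top 1))"

definition max_strand :: "bool \<Rightarrow> strand" where
  "max_strand a = (if a then Arc (Bot 0) (Bot 1) else Arc (Bot 1) (Bot 0))"

text \<open>The tangle without chords, i.e. its underlying one-manifold.\<close>

primrec bare :: "tangle \<Rightarrow> jdiag" where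
  "bare (Straight u) = chord_diag (letters u) id []"
| "bare (Crossing r a b) = chord_diag [a, b] (\<lambda>i. 1 - i) []"
| "bare (Minimum a) = JD [] [(min_strand a, [])] []"
| "bare (Maximum a) = JD [] [(max_strand a, [])] []"
| "bare (Assoc u v w) = chord_diag (letters u @ letters v @ letters w) id []"
| "bare (AssocInv u v w) = chord_diag (letters u @ letters v @ letters w) id []"
| "bare (Juxt S T) = juxt_op S T (bare S) (bare T)"
| "bare (Comp S T) = comp_op S T (bare S) (bare T)"


section \<open>The Kontsevich integral of tangles\<close>

text \<open>
  The series \<open>\<Phi>\<close> with \<open>A\<close> and \<open>B\<close> replaced by the cabled chords: the sum over all chords joining a
  strand of the first (second) cable to one of the second (third) cable, with a sign \<open>-1\<close> for each
  end on a downward strand. The leftmost letter of a word is put on top.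
\<close>

definition cabled ::
  "nc_series \<Rightarrow> bool list \<Rightarrow> bool list \<Rightarrow> bool list \<Rightarrow> nat \<Rightarrow> chain" where
  "cabled \<Phi> us vs ws n =
     (let os = us @ vs @ ws;
          p = length us; q = length us + length vs; r = length os;
          chords = (\<lambda>l. if l then {0..<p} \<times> {p..<q} else {p..<q} \<times> {q..<r});
          sg = (\<lambda>i. if os ! i then 1 else - 1)
      in \<Sum>\<omega> | length \<omega> = n. \<Sum>cs\<in>listset (map chords \<omega>).
           Poly_Mapping.single (chord_diag os id cs)
             (\<Phi> \<omega> * prod_list (map (\<lambda>(i, j). sg i * sg j) cs)))"

text \<open>
  The sign of a crossing is positive iff \<open>r \<longleftrightarrow> (a \<longleftrightarrow> b)\<close>: it is positive if both strands are directed
  upwards and the one from lower left to upper right is the upper one, and reversing a strand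
  changes it.
\<close>

primrec kontsevich :: "(nat \<Rightarrow> chain) \<Rightarrow> tangle \<Rightarrow> nat \<Rightarrow> chain" where
  "kontsevich s (Straight u) = in_degree0 (bare (Straight u))"
| "kontsevich s (Crossing r a b) = (\<lambda>n. Poly_Mapping.single
     (chord_diag [a, b] (\<lambda>i. 1 - i) (replicate n (0, 1)))
     ((if r \<longleftrightarrow> (a \<longleftrightarrow> b) then 1/2 else - 1/2) ^ n / fact n))"
| "kontsevich s (Minimum a) = (\<lambda>n.
     linext (\<lambda>D. Poly_Mapping.single (extremum_diag (min_strand a) D) 1) (s n))"
| "kontsevich s (Maximum a) = (\<lambda>n.
     linext (\<lambda>D. Poly_Mapping.single (extremum_diag (max_strand a) D) 1) (s n))"
| "kontsevich s (Assoc u v w) = cabled KZ_associator (letters u) (letters v) (letters w)"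
| "kontsevich s (AssocInv u v w) =
     cabled (nc_inverse KZ_associator) (letters u) (letters v) (letters w)"
| "kontsevich s (Juxt S T) = graded_prod (juxt_op S T) (kontsevich s S) (kontsevich s T)"
| "kontsevich s (Comp S T) = graded_prod (comp_op S T) (kontsevich s S) (kontsevich s T)"


section \<open>Framed links in the three-sphere\<close>

text \<open>
  The sphere is the unit sphere of \<open>real^3 \<times> real\<close>. A link with \<open>m\<close> components and its framing are
  given by \<open>m\<close> one-periodic curves \<open>F i\<close> and vector fields \<open>V i\<close> along them.
\<close>

type_synonym curves = "nat \<Rightarrow> real \<Rightarrow> (real^3) \<times> real"

definition framed_link :: "nat \<Rightarrow> curves \<times> curves \<Rightarrow> bool" where
  "framed_link m L \<longleftrightarrow> (case L of (F, V) \<Rightarrow>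
     (\<forall>i<m. F i C1_differentiable_on UNIV \<and> continuous_on UNIV (V i)
        \<and> (\<forall>t. F i (t + 1) = F i t \<and> V i (t + 1) = V i t
             \<and> F i t \<in> sphere 0 1 \<and> F i t \<bullet> V i t = 0
             \<and> vector_derivative (F i) (at t) \<noteq> 0
             \<and> V i t \<notin> span {vector_derivative (F i) (at t)}))
     \<and> inj_on (\<lambda>(i, t). F i t) ({..<m} \<times> {0..<1}))"

text \<open>
  Isotopy of framed oriented links: a path in the space of \<open>C\<^sup>1\<close> embeddings with framings. By isotopy
  extension this is the same as ambient isotopy.
\<close>

definition framed_isotopic :: "nat \<Rightarrow> curves \<times> curves \<Rightarrow> curves \<times> curves \<Rightarrow> bool" where
  "framed_isotopic m L L' \<longleftrightarrow> (\<exists>H W.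
     (\<forall>u\<in>{0..1::real}. framed_link m (H u, W u))
     \<and> (\<forall>i<m. H 0 i = fst L i \<and> W 0 i = snd L i \<and> H 1 i = fst L' i \<and> W 1 i = snd L' i
        \<and> continuous_on ({0..1} \<times> UNIV) (\<lambda>(u, t). H u i t)
        \<and> continuous_on ({0..1} \<times> UNIV) (\<lambda>(u, t). vector_derivative (H u i) (at t))
        \<and> continuous_on ({0..1} \<times> UNIV) (\<lambda>(u, t). W u i t)))"

text \<open>Inverse stereographic projection from \<open>(0, 1)\<close>; it preserves the standard orientations.\<close>

definition stereo_inv :: "real^3 \<Rightarrow> (real^3) \<times> real" where
  "stereo_inv p = ((2 / (1 + (norm p)\<^sup>2)) *\<^sub>R p, ((norm p)\<^sup>2 - 1) / ((norm p)\<^sup>2 + 1))"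

text \<open>
  Diagrams of curves \<open>K i\<close> (\<open>i < m\<close>) in space: the first coordinate points to the right, the third
  one upwards, and the second one away from the viewer.

  \<open>strands_in m K x0 x1 h\<close> is the set of parameters \<open>(i, t)\<close> of the points at height \<open>h\<close> that are
  projected to \<open>[x0, x1]\<close>; \<open>level m K x0 x1 h os\<close> says that at height \<open>h\<close> there are, from left to
  right, strands in directions \<open>os\<close>.
\<close>

definition strands_in ::
  "nat \<Rightarrow> (nat \<Rightarrow> real \<Rightarrow> real^3) \<Rightarrow> real \<Rightarrow> real \<Rightarrow> real \<Rightarrow> (nat \<times> real) set" where
  "strands_in m K x0 x1 h =
     {(i, t). i < m \<and> t \<in> {0..<1} \<and> K i t $ 3 = h \<and> K i t $ 1 \<in> {x0..x1}}"

definition pos :: "(nat \<Rightarrow> real \<Rightarrow> real^3) \<Rightarrow> nat \<times> real \<Rightarrow> real^3" where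
  "pos K p = K (fst p) (snd p)"

definition vel :: "(nat \<Rightarrow> real \<Rightarrow> real^3) \<Rightarrow> nat \<times> real \<Rightarrow> real^3" where
  "vel K p = vector_derivative (K (fst p)) (at (snd p))"

definition level ::
  "nat \<Rightarrow> (nat \<Rightarrow> real \<Rightarrow> real^3) \<Rightarrow> real \<Rightarrow> real \<Rightarrow> real \<Rightarrow> bool list \<Rightarrow> bool" where
  "level m K x0 x1 h os \<longleftrightarrow> (\<exists>ps. set ps = strands_in m K x0 x1 h
     \<and> sorted_wrt (\<lambda>p q. pos K p $ 1 < pos K q $ 1) ps
     \<and> (\<forall>p\<in>set ps. pos K p $ 1 \<in> {x0<..<x1} \<and> vel K p $ 3 \<noteq> 0)
     \<and> map (\<lambda>p. vel K p $ 3 > 0) ps = os)"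

definition crossing_at ::
  "nat \<Rightarrow> (nat \<Rightarrow> real \<Rightarrow> real^3) \<Rightarrow> real \<Rightarrow> real \<Rightarrow> real \<Rightarrow> bool \<Rightarrow> bool \<Rightarrow> bool \<Rightarrow> bool" where
  "crossing_at m K x0 x1 h r a b \<longleftrightarrow> (\<exists>p q. strands_in m K x0 x1 h = {p, q}
     \<and> pos K p $ 1 = pos K q $ 1 \<and> pos K p $ 1 \<in> {x0<..<x1}
     \<and> vel K p $ 3 \<noteq> 0 \<and> vel K q $ 3 \<noteq> 0
     \<and> (vel K p $ 3 > 0 \<longleftrightarrow> a) \<and> (vel K q $ 3 > 0 \<longleftrightarrow> b)
     \<and> vel K p $ 1 / vel K p $ 3 > vel K q $ 1 / vel K q $ 3
     \<and> (if r then pos K p $ 2 < pos K q $ 2 else pos K q $ 2 < pos K p $ 2))"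

definition extremum_at ::
  "nat \<Rightarrow> (nat \<Rightarrow> real \<Rightarrow> real^3) \<Rightarrow> real \<Rightarrow> real \<Rightarrow> real \<Rightarrow> bool" where
  "extremum_at m K x0 x1 h \<longleftrightarrow> (\<exists>p. strands_in m K x0 x1 h = {p}
     \<and> pos K p $ 1 \<in> {x0<..<x1} \<and> vel K p $ 3 = 0 \<and> vel K p $ 1 \<noteq> 0)"

text \<open>
  \<open>looks_like T m K x0 x1 z0 z1\<close>: over the rectangle \<open>[x0, x1] \<times> [z0, z1]\<close> of the projection plane,
  the curves form the tangle \<open>T\<close>. Parenthesizations have no geometric content.
\<close>

primrec looks_like ::
  "tangle \<Rightarrow> nat \<Rightarrow> (nat \<Rightarrow> real \<Rightarrow> real^3) \<Rightarrow> real \<Rightarrow> real \<Rightarrow> real \<Rightarrow> real \<Rightarrow> bool" where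
  "looks_like (Straight u) m K x0 x1 z0 z1 \<longleftrightarrow>
     z0 < z1 \<and> (\<forall>h\<in>{z0..z1}. level m K x0 x1 h (letters u))"
| "looks_like (Assoc u v w) m K x0 x1 z0 z1 \<longleftrightarrow>
     z0 < z1 \<and> (\<forall>h\<in>{z0..z1}. level m K x0 x1 h (letters u @ letters v @ letters w))"
| "looks_like (AssocInv u v w) m K x0 x1 z0 z1 \<longleftrightarrow>
     z0 < z1 \<and> (\<forall>h\<in>{z0..z1}. level m K x0 x1 h (letters u @ letters v @ letters w))"
| "looks_like (Crossing r a b) m K x0 x1 z0 z1 \<longleftrightarrow> (\<exists>c\<in>{z0<..<z1}.
     (\<forall>h\<in>{z0..<c}. level m K x0 x1 h [a, b]) \<and> crossing_at m K x0 x1 c r a b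
     \<and> (\<forall>h\<in>{c<..z1}. level m K x0 x1 h [b, a]))"
| "looks_like (Minimum a) m K x0 x1 z0 z1 \<longleftrightarrow> (\<exists>c\<in>{z0<..<z1}.
     (\<forall>h\<in>{z0..<c}. level m K x0 x1 h []) \<and> extremum_at m K x0 x1 c
     \<and> (\<forall>h\<in>{c<..z1}. level m K x0 x1 h [a, \<not> a]))"
| "looks_like (Maximum a) m K x0 x1 z0 z1 \<longleftrightarrow> (\<exists>c\<in>{z0<..<z1}.
     (\<forall>h\<in>{z0..<c}. level m K x0 x1 h [a, \<not> a]) \<and> extremum_at m K x0 x1 c
     \<and> (\<forall>h\<in>{c<..z1}. level m K x0 x1 h []))"
| "looks_like (Juxt S T) m K x0 x1 z0 z1 \<longleftrightarrow> (\<exists>x\<in>{x0<..<x1}.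
     looks_like S m K x0 x z0 z1 \<and> looks_like T m K x x1 z0 z1)"
| "looks_like (Comp S T) m K x0 x1 z0 z1 \<longleftrightarrow> (\<exists>z\<in>{z0<..<z1}.
     looks_like S m K x0 x1 z0 z \<and> looks_like T m K x0 x1 z z1)"

text \<open>
  The projection being an immersion, its blackboard framing is homotopic to the constant framing
  orthogonal to the projection plane, and the latter is used here.
\<close>

definition presents :: "tangle \<Rightarrow> nat \<Rightarrow> curves \<times> curves \<Rightarrow> bool" where
  "presents T m L \<longleftrightarrow> (\<exists>K x0 x1 z0 z1.
     (\<forall>i<m. \<forall>t. K i t $ 1 \<in> {x0<..<x1} \<and> K i t $ 3 \<in> {z0<..<z1})
     \<and> looks_like T m K x0 x1 z0 z1
     \<and> framed_isotopic m
         (\<lambda>i t. stereo_inv (K i t),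
          \<lambda>i t. frechet_derivative stereo_inv (at (K i t)) (axis 2 1)) L)"

abbreviation circles :: "nat \<Rightarrow> strand list" where
  "circles m \<equiv> replicate m Circ"

definition closed_tangle :: "nat \<Rightarrow> tangle \<Rightarrow> bool" where
  "closed_tangle m T \<longleftrightarrow> composable T \<and> bottom T = Emp \<and> top_word T = Emp
     \<and> map fst (comps (bare T)) = circles m"

text \<open>
  \<open>z\<close> represents the Kontsevich integral of \<open>L\<close>, calculated from some presentation \<open>T\<close> of \<open>L\<close>. The
  circles are numbered as they arise in \<open>T\<close>. The parameter \<open>s\<close> is the value at the extrema.
\<close>

definition kontsevich_integral ::
  "(nat \<Rightarrow> chain) \<Rightarrow> nat \<Rightarrow> curves \<times> curves \<Rightarrow> (nat \<Rightarrow> chain) \<Rightarrow> bool" where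
  "kontsevich_integral s m L z \<longleftrightarrow> (\<exists>T. closed_tangle m T \<and> presents T m L
     \<and> (\<forall>n. z n \<in> jchains UNIV (circles m) {} \<and> homogeneous n (z n)
          \<and> z n - kontsevich s T n \<in> jspan UNIV (circles m) {}))"

end

theory Submission
  imports Defs
begin

text \<open>
  The Gromov norm of a class is at most the sum of the absolute values of the coefficients of any
  chain representing it. A presentation of the link by a tangle provides such a chain in every
  degree, so it suffices that the \<open>l1\<close>-norm of the degree \<open>n\<close> part of this particular chain grows at
  most geometrically with \<open>n\<close>. The operations on tangles preserve this growth: composition and
  juxtaposition send a pair of diagrams to one diagram, hence the \<open>l1\<close>-norm is submultiplicative,
  and the norms of the graded pieces of a product are bounded by a convolution. It remains to treat
  the elementary tangles.

  A crossing contributes an exponential. At an extremum stand power series in wheels; their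
  coefficients come from \<open>log (sinh (t/2) / (t/2))\<close>, which converges near 0, the symmetrization is an
  average and does not increase the norm, and a power series without constant term can be
  substituted into a power series with bounded coefficients without leaving the geometric range
  (\<open>geom_bounded_power_sum\<close>). A change of parenthesization contributes the KZ associator or its
  inverse, where every word of length \<open>n\<close> is expanded into at most \<open>K^n\<close> chord diagrams. So what is
  needed is that the coefficients of the associator grow at most geometrically with the length of
  the word.

  For the latter, write the solution normalized at 0 as \<open>G\<^sub>0 z = P z \<cdot> z^(A/2\<pi>i)\<close>. The KZ equation is
  equivalent to a recursion for the Taylor coefficients of \<open>P\<close>, by which all of them are bounded by
  1 in absolute value, at every word (\<open>norm_kz_coeff_le\<close>); here it matters that \<open>1/2\<pi> \<le> 1/3\<close>. At
  \<open>z = 1/2\<close> the series for \<open>P\<close> thus converges with a bound that does not depend on the word. The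
  solution \<open>G\<^sub>1\<close> normalized at 1 arises from \<open>G\<^sub>0\<close> by the symmetry that exchanges 0 with 1 and \<open>A\<close> with \<open>B\<close>. Finally
  \<open>\<Phi> = G\<^sub>1(1/2)\<^sup>-\<^sup>1 G\<^sub>0(1/2)\<close>, and products and inverses of geometrically bounded series are
  geometrically bounded. That \<open>G\<^sub>1(z)\<^sup>-\<^sup>1 G\<^sub>0(z)\<close> depends neither on \<open>z\<close> nor on the choice
  of the normalized solutions follows by induction on words, as the derivative of the coefficient at a word involves only the coefficient at its tail.

  If the class is rational, one may ask for the norm over the rational numbers. Taking real parts and
  approximating the coefficients of the relations used by rational ones shows that it does not
  exceed the complex norm (\<open>gromov_norm_Rats_le\<close>). It is a rational number: after renaming edges and
  discarding all other degrees only finitely many diagrams occur, and the minimum of the \<open>l1\<close>-norm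
  over an affine space of finite dimension is attained at one of finitely many points that are
  determined by their supports (\<open>l1_minimum_attained\<close>).
\<close>

section \<open>Geometrically bounded sequences\<close>

text \<open>
  The exponent \<open>Suc n\<close> lets a single constant serve both as a ratio and as a factor in degree 0.
\<close>

definition geom_bounded :: "(nat \<Rightarrow> real) \<Rightarrow> bool" where
  "geom_bounded u \<longleftrightarrow> (\<exists>C\<ge>1. \<forall>n. u n \<le> C ^ Suc n)"

lemma geom_boundedI:
  assumes "\<And>n. u n \<le> M * C ^ n"
  shows "geom_bounded u"
proof -
  define D where "D = max 1 (max \<bar>M\<bar> \<bar>C\<bar>)"
  have "u n \<le> D ^ Suc n" for n
  proof -
    have "u n \<le> \<bar>M\<bar> * \<bar>C\<bar> ^ n"
      using assms[of n] by (metis abs_ge_self abs_mult order_trans power_abs)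
    also have "\<dots> \<le> D * D ^ n"
      by (intro mult_mono power_mono) (auto simp: D_def)
    finally show ?thesis by simp
  qed
  moreover have "D \<ge> 1" by (simp add: D_def)
  ultimately show ?thesis unfolding geom_bounded_def by blast
qed

lemma geom_bounded_mono:
  assumes "geom_bounded v" "\<And>n. u n \<le> v n"
  shows "geom_bounded u"
  using assms order_trans unfolding geom_bounded_def by blast

lemma geom_boundedE_pos:
  assumes "geom_bounded u"
  obtains C where "C \<ge> 1" "\<And>n. n > 0 \<Longrightarrow> u n \<le> C ^ n"
proof -
  obtain C where C: "C \<ge> 1" "\<And>n. u n \<le> C ^ Suc n"
    using assms unfolding geom_bounded_def by blast
  have "u n \<le> (C\<^sup>2) ^ n" if "n > 0" for n
  proof -
    have "u n \<le> C ^ Suc n" by (rule C)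
    also have "\<dots> \<le> C ^ (2 * n)" using that C by (intro power_increasing) auto
    finally show ?thesis by (simp add: power_mult)
  qed
  then show ?thesis using C that[of "C\<^sup>2"] by (simp add: one_le_power)
qed

lemma Suc_le_two_power: "1 + real n \<le> 2 ^ n"
  by (induction n) auto

lemma geom_bounded_convolution:
  assumes "geom_bounded u" "geom_bounded v" "\<And>n. 0 \<le> u n" "\<And>n. 0 \<le> v n"
  shows "geom_bounded (\<lambda>n. \<Sum>i\<le>n. u i * v (n - i))"
proof -
  obtain C D where C: "C \<ge> 1" "\<And>n. u n \<le> C ^ Suc n" and D: "D \<ge> 1" "\<And>n. v n \<le> D ^ Suc n"
    using assms unfolding geom_bounded_def by metis
  define E where "E = max C D"
  have E: "E \<ge> 1" "C \<le> E" "D \<le> E" using C by (auto simp: E_def)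
  have "(\<Sum>i\<le>n. u i * v (n - i)) \<le> E\<^sup>2 * (2 * E) ^ n" for n
  proof -
    have "u i * v (n - i) \<le> E\<^sup>2 * E ^ n" if "i \<le> n" for i
    proof -
      have "u i * v (n - i) \<le> E ^ Suc i * E ^ Suc (n - i)"
      proof (rule mult_mono)
        show "u i \<le> E ^ Suc i" by (rule order_trans[OF C(2) power_mono]) (use C E in auto)
        show "v (n - i) \<le> E ^ Suc (n - i)" by (rule order_trans[OF D(2) power_mono]) (use D E in auto)
      qed (use E assms(3,4) in auto)
      also have "\<dots> = E ^ (Suc i + Suc (n - i))" by (rule power_add[symmetric])
      also have "Suc i + Suc (n - i) = 2 + n" using that by simp
      finally show ?thesis by (simp add: power_add power2_eq_square)
    qed
    then have "(\<Sum>i\<le>n. u i * v (n - i)) \<le> (\<Sum>i\<le>n. E\<^sup>2 * E ^ n)"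
      by (intro sum_mono) auto
    also have "\<dots> = (Suc n) * (E\<^sup>2 * E ^ n)" by simp
    also have "\<dots> \<le> 2 ^ n * (E\<^sup>2 * E ^ n)"
      by (rule mult_right_mono) (use E in \<open>auto intro: Suc_le_two_power\<close>)
    finally show ?thesis by (simp add: power_mult_distrib mult_ac)
  qed
  then show ?thesis by (rule geom_boundedI)
qed

text \<open>
  The geometric series \<open>1/2 + 1/4 + \<dots> \<le> 1\<close>: doubling the ratio absorbs a convolution with a sequence
  that starts in degree 1.
\<close>

lemma sum_geometric_le:
  assumes "C \<ge> (0::real)"
  shows "(\<Sum>i=1..n. C ^ i * (2 * C) ^ (n - i)) \<le> (2 * C) ^ n"
proof -
  have "C ^ i * (2 * C) ^ (n - i) = C ^ n * 2 ^ (n - i)" if "i \<in> {1..n}" for i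
  proof -
    have "C ^ n = C ^ i * C ^ (n - i)" using that by (simp flip: power_add)
    then show ?thesis by (simp add: power_mult_distrib)
  qed
  then have "(\<Sum>i=1..n. C ^ i * (2 * C) ^ (n - i)) = C ^ n * (\<Sum>i=1..n. 2 ^ (n - i))"
    unfolding sum_distrib_left by (rule sum.cong[OF refl])
  also have "(\<Sum>i=1..n. 2 ^ (n - i)) = (\<Sum>j<n. 2 ^ j :: real)"
    by (rule sum.reindex_bij_witness[of _ "\<lambda>j. n - j" "\<lambda>i. n - i"]) auto
  also have "\<dots> \<le> 2 ^ n" by (subst geometric_sum) auto
  finally have "(\<Sum>i=1..n. C ^ i * (2 * C) ^ (n - i)) \<le> C ^ n * 2 ^ n"
    using assms by (simp add: mult_left_mono)
  then show ?thesis by (simp add: power_mult_distrib mult.commute)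
qed

text \<open>
  The powers of a sequence that vanishes in degree 0. The bound does not depend on the exponent,
  because by \<open>sum_geometric_le\<close> each further factor is absorbed at no cost.
\<close>

lemma iterated_convolution_le:
  fixes v :: "nat \<Rightarrow> nat \<Rightarrow> real"
  assumes C: "C \<ge> 1" and u: "u 0 \<le> 0" "\<And>n. 0 \<le> u n" "\<And>n. n > 0 \<Longrightarrow> u n \<le> C ^ n"
    and v0: "\<And>n. v 0 n \<le> (if n = 0 then 1 else 0)"
    and step: "\<And>k n. v (Suc k) n \<le> (\<Sum>i\<le>n. u i * v k (n - i))"
  shows "v k n \<le> (2 * C) ^ n"
proof (induction k arbitrary: n)
  case 0
  have "v 0 n \<le> (if n = 0 then 1 else 0)" by (rule v0)
  also have "\<dots> \<le> (2 * C) ^ n" using C by simp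
  finally show ?case .
next
  case (Suc k)
  have "u 0 = 0" using u(1) u(2)[of 0] by simp
  have "v (Suc k) n \<le> (\<Sum>i\<le>n. u i * v k (n - i))" by (rule step)
  also have "\<dots> = (\<Sum>i=1..n. u i * v k (n - i))"
    by (rule sum.mono_neutral_right) (auto simp: \<open>u 0 = 0\<close> Suc_le_eq)
  also have "\<dots> \<le> (\<Sum>i=1..n. C ^ i * (2 * C) ^ (n - i))"
  proof (rule sum_mono)
    fix i assume i: "i \<in> {1..n}"
    have "u i * v k (n - i) \<le> u i * (2 * C) ^ (n - i)" by (intro mult_left_mono Suc u)
    also have "\<dots> \<le> C ^ i * (2 * C) ^ (n - i)"
      using i C by (intro mult_right_mono u) auto
    finally show "u i * v k (n - i) \<le> C ^ i * (2 * C) ^ (n - i)" .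
  qed
  also have "\<dots> \<le> (2 * C) ^ n" using C by (intro sum_geometric_le) auto
  finally show ?case .
qed

lemma gevrey_0_of_geom_bounded:
  fixes a :: "nat \<Rightarrow> real"
  assumes "geom_bounded (\<lambda>n. \<bar>a n\<bar>)"
  shows "gevrey 0 a" "conv_radius a > 0"
proof -
  obtain C where C: "C \<ge> 1" "\<And>n. n > 0 \<Longrightarrow> \<bar>a n\<bar> \<le> C ^ n"
    using geom_boundedE_pos[OF assms] by metis
  show "gevrey 0 a" unfolding gevrey_def
    using C by (intro exI[of _ C]) auto
  have "ereal (1 / (2 * C)) \<le> conv_radius a"
  proof (rule conv_radius_geI_ex')
    fix r :: real assume r: "0 < r" "ereal r < ereal (1 / (2 * C))"
    have rc: "r * C < 1 / 2" using r C by (simp add: field_simps)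
    have "summable (\<lambda>n. norm (a n * of_real r ^ n))"
    proof (rule summable_comparison_test_ev)
      show "\<forall>\<^sub>F n in sequentially. norm (norm (a n * of_real r ^ n)) \<le> (C * r) ^ n"
        using eventually_gt_at_top[of 0]
        by eventually_elim (use C r in \<open>auto simp: abs_mult power_mult_distrib intro!: mult_right_mono\<close>)
      show "summable (\<lambda>n. (C * r) ^ n)" using rc C r by (intro summable_geometric) (auto simp: mult.commute abs_mult)
    qed
    then show "summable (\<lambda>n. a n * of_real r ^ n)" by (rule summable_norm_cancel)
  qed
  moreover have "ereal (1 / (2 * C)) > 0" using C by simp
  ultimately show "conv_radius a > 0" by (rule order.strict_trans2[rotated])
qed

section \<open>Chains and their l1-norm\<close>

text \<open>
  The quantity minimized in the definition of the Gromov norm.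
\<close>

definition l1 :: "('a \<Rightarrow>\<^sub>0 complex) \<Rightarrow> real" where
  "l1 p = (\<Sum>D\<in>Poly_Mapping.keys p. norm (Poly_Mapping.lookup p D))"

lemma l1_superset: "finite S \<Longrightarrow> Poly_Mapping.keys p \<subseteq> S \<Longrightarrow> l1 p = (\<Sum>D\<in>S. norm (Poly_Mapping.lookup p D))"
  unfolding l1_def by (rule sum.mono_neutral_left) (auto simp flip: lookup_not_eq_zero_eq_in_keys)

lemma l1_nonneg [simp]: "0 \<le> l1 p" by (simp add: l1_def sum_nonneg)

lemma l1_0 [simp]: "l1 0 = 0" by (simp add: l1_def)

lemma l1_single [simp]: "l1 (Poly_Mapping.single D c) = norm c"
  by (cases "c = 0") (simp_all add: l1_def del: l1_nonneg)

lemma l1_add: "l1 (p + q) \<le> l1 p + l1 q"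
proof -
  let ?S = "Poly_Mapping.keys p \<union> Poly_Mapping.keys q"
  have "l1 (p + q) = (\<Sum>D\<in>?S. norm (Poly_Mapping.lookup (p + q) D))"
    by (rule l1_superset) (simp_all add: Poly_Mapping.keys_add)
  also have "\<dots> \<le> (\<Sum>D\<in>?S. norm (Poly_Mapping.lookup p D) + norm (Poly_Mapping.lookup q D))"
    by (intro sum_mono) (simp add: lookup_add norm_triangle_ineq)
  also have "\<dots> = l1 p + l1 q"
    using l1_superset[of ?S p] l1_superset[of ?S q] by (simp add: sum.distrib)
  finally show ?thesis .
qed

lemma l1_sum: "l1 (\<Sum>i\<in>I. f i) \<le> (\<Sum>i\<in>I. l1 (f i))"
proof (induction I rule: infinite_finite_induct)
  case (insert i I)
  then show ?case using l1_add[of "f i" "\<Sum>i\<in>I. f i"] by simp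
qed auto

lemma lookup_cscale [simp]: "Poly_Mapping.lookup (cscale a p) D = a * Poly_Mapping.lookup p D"
  by (auto simp: cscale_def Poly_Mapping.map.rep_eq when_def)

lemma keys_cscale: "Poly_Mapping.keys (cscale a p) \<subseteq> Poly_Mapping.keys p"
  by (auto simp flip: lookup_not_eq_zero_eq_in_keys)

lemma l1_cscale [simp]: "l1 (cscale a p) = norm a * l1 p"
proof -
  have "l1 (cscale a p) = (\<Sum>D\<in>Poly_Mapping.keys p. norm (Poly_Mapping.lookup (cscale a p) D))"
    by (rule l1_superset) (simp_all add: keys_cscale)
  also have "\<dots> = norm a * l1 p"
    by (simp only: l1_def lookup_cscale norm_mult sum_distrib_left)
  finally show ?thesis .
qed

lemma cscale_simps [simp]:
  "cscale 0 p = 0" "cscale 1 p = p" "cscale a 0 = 0" "cscale a (cscale b p) = cscale (a * b) p"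
  by (auto intro!: poly_mapping_eqI)

lemma cscale_add_left: "cscale (a + b) p = cscale a p + cscale b p"
  by (auto intro!: poly_mapping_eqI simp: lookup_add distrib_right)

lemma cscale_add_right: "cscale a (p + q) = cscale a p + cscale a q"
  by (auto intro!: poly_mapping_eqI simp: lookup_add distrib_left)

lemma cscale_diff_right: "cscale a (p - q) = cscale a p - cscale a q"
  by (auto intro!: poly_mapping_eqI simp: lookup_minus right_diff_distrib)

lemma cscale_sum: "cscale a (\<Sum>i\<in>I. f i) = (\<Sum>i\<in>I. cscale a (f i))"
  by (induction I rule: infinite_finite_induct) (simp_all add: cscale_add_right)

lemma cscale_single: "cscale a (Poly_Mapping.single D b) = Poly_Mapping.single D (a * b)"
  by (auto intro!: poly_mapping_eqI simp: lookup_single when_def)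

lemma chain_eq_sum:
  assumes "finite S" "Poly_Mapping.keys p \<subseteq> S"
  shows "p = (\<Sum>D\<in>S. Poly_Mapping.single D (Poly_Mapping.lookup p D))"
proof (rule poly_mapping_eqI)
  fix E
  have "E \<notin> S \<Longrightarrow> Poly_Mapping.lookup p E = 0" using assms(2) by (meson in_keys_iff subsetD)
  then show "Poly_Mapping.lookup p E
    = Poly_Mapping.lookup (\<Sum>D\<in>S. Poly_Mapping.single D (Poly_Mapping.lookup p D)) E"
    using assms(1) by (simp add: lookup_sum lookup_single when_def)
qed

lemma linext_superset:
  assumes "finite S" "Poly_Mapping.keys p \<subseteq> S"
  shows "linext f p = (\<Sum>D\<in>S. cscale (Poly_Mapping.lookup p D) (f D))"
  unfolding linext_def using assms
  by (intro sum.mono_neutral_left) (auto simp flip: lookup_not_eq_zero_eq_in_keys)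

lemma linext_add: "linext f (p + q) = linext f p + linext f q"
proof -
  let ?S = "Poly_Mapping.keys p \<union> Poly_Mapping.keys q"
  have "linext f (p + q) = (\<Sum>D\<in>?S. cscale (Poly_Mapping.lookup (p + q) D) (f D))"
    by (rule linext_superset) (simp_all add: Poly_Mapping.keys_add)
  also have "\<dots> = (\<Sum>D\<in>?S. cscale (Poly_Mapping.lookup p D) (f D))
      + (\<Sum>D\<in>?S. cscale (Poly_Mapping.lookup q D) (f D))"
    by (simp add: lookup_add cscale_add_left sum.distrib)
  also have "\<dots> = linext f p + linext f q"
    using linext_superset[of ?S p f] linext_superset[of ?S q f] by simp
  finally show ?thesis .
qed

lemma linext_cscale: "linext f (cscale a p) = cscale a (linext f p)"
  using linext_superset[of "Poly_Mapping.keys p" "cscale a p" f]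
  by (simp add: keys_cscale linext_def cscale_sum)

lemma linext_sum: "linext f (\<Sum>i\<in>I. p i) = (\<Sum>i\<in>I. linext f (p i))"
  by (induction I rule: infinite_finite_induct) (simp_all add: linext_add, simp_all add: linext_def)

lemma l1_mono:
  assumes "\<And>D. norm (Poly_Mapping.lookup p D) \<le> norm (Poly_Mapping.lookup q D)"
  shows "l1 p \<le> l1 q"
proof -
  have "Poly_Mapping.keys p \<subseteq> Poly_Mapping.keys q"
  proof
    fix D assume "D \<in> Poly_Mapping.keys p"
    then show "D \<in> Poly_Mapping.keys q"
      using assms[of D] by (metis in_keys_iff norm_le_zero_iff norm_zero)
  qed
  then have "l1 p = (\<Sum>D\<in>Poly_Mapping.keys q. norm (Poly_Mapping.lookup p D))"
    by (intro l1_superset) auto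
  also have "\<dots> \<le> l1 q" unfolding l1_def by (intro sum_mono assms)
  finally show ?thesis .
qed

lemma l1_linext:
  assumes "\<And>D. l1 (f D) \<le> B"
  shows "l1 (linext f p) \<le> B * l1 p"
proof -
  have "l1 (linext f p) \<le> (\<Sum>D\<in>Poly_Mapping.keys p. norm (Poly_Mapping.lookup p D) * l1 (f D))"
    unfolding linext_def by (rule order_trans[OF l1_sum]) simp
  also have "\<dots> \<le> (\<Sum>D\<in>Poly_Mapping.keys p. norm (Poly_Mapping.lookup p D) * B)"
    by (intro sum_mono mult_left_mono assms) auto
  also have "\<dots> = B * l1 p" by (simp only: l1_def sum_distrib_right[symmetric] mult.commute[of B])
  finally show ?thesis .
qed

text \<open>
  A pair of diagrams is sent to one diagram with coefficient 1, so nothing is lost beyond the product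
  of the coefficients.
\<close>

lemma l1_bilin: "l1 (bilin f p q) \<le> l1 p * l1 q"
  unfolding bilin_def
proof (subst mult.commute, rule l1_linext)
  show "l1 (linext (\<lambda>E. Poly_Mapping.single (f D E) 1) q) \<le> l1 q" for D
    using l1_linext[of "\<lambda>E. Poly_Mapping.single (f D E) 1" 1 q] by simp
qed

lemma l1_graded_prod: "l1 (graded_prod f z z' n) \<le> (\<Sum>i\<le>n. l1 (z i) * l1 (z' (n - i)))"
  unfolding graded_prod_def by (rule order_trans[OF l1_sum]) (intro sum_mono l1_bilin)

abbreviation geom_bounded_series :: "(nat \<Rightarrow> chain) \<Rightarrow> bool" where
  "geom_bounded_series z \<equiv> geom_bounded (\<lambda>n. l1 (z n))"

lemma geom_bounded_graded_prod:
  assumes "geom_bounded_series z" "geom_bounded_series z'"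
  shows "geom_bounded_series (graded_prod f z z')"
  using geom_bounded_convolution[OF assms] by (rule geom_bounded_mono) (auto intro: l1_graded_prod)

lemma l1_in_degree0 [simp]: "l1 (in_degree0 D n) = (if n = 0 then 1 else 0)"
  by (simp add: in_degree0_def)

text \<open>
  The exponential series and the binomial series of a square root have coefficients of absolute
  value at most 1. In degree \<open>n\<close> only \<open>n + 1\<close> powers contribute, which another factor \<open>2 ^ n\<close> absorbs.
\<close>

lemma geom_bounded_power_sum:
  assumes z: "geom_bounded_series z" "z 0 = 0" and a: "\<And>k. norm (a k) \<le> 1"
  shows "geom_bounded_series (power_sum f D a z)"
proof -
  obtain C where C: "C \<ge> 1" "\<And>n. n > 0 \<Longrightarrow> l1 (z n) \<le> C ^ n"
    using geom_boundedE_pos[OF z(1)] by metis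
  have pow: "l1 ((graded_prod f z ^^ k) (in_degree0 D) n) \<le> (2 * C) ^ n" for k n
    by (rule iterated_convolution_le[where u = "\<lambda>n. l1 (z n)"
          and v = "\<lambda>k n. l1 ((graded_prod f z ^^ k) (in_degree0 D) n)"])
       (use C z in \<open>simp_all add: l1_graded_prod\<close>)
  have "l1 (power_sum f D a z n) \<le> 1 * (4 * C) ^ n" for n
  proof -
    have "l1 (power_sum f D a z n) \<le> (\<Sum>k\<le>n. norm (a k) * l1 ((graded_prod f z ^^ k) (in_degree0 D) n))"
      unfolding power_sum_def by (rule order_trans[OF l1_sum]) simp
    also have "\<dots> \<le> (\<Sum>k\<le>n. 1 * (2 * C) ^ n)"
      by (intro sum_mono mult_mono a pow) auto
    also have "\<dots> = Suc n * (2 * C) ^ n" by simp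
    also have "\<dots> \<le> 2 ^ n * (2 * C) ^ n"
      by (rule mult_right_mono) (use C in \<open>auto intro: Suc_le_two_power\<close>)
    also have "\<dots> = (4 * C) ^ n" by (subst power_mult_distrib[symmetric]) simp
    finally show ?thesis by simp
  qed
  then show ?thesis by (rule geom_boundedI)
qed

section \<open>The series at the extrema\<close>

text \<open>
  The series is a logarithm composed with \<open>h = sinh (t/2) / (t/2) - 1\<close>. Both have coefficients of
  absolute value at most 1, and \<open>h\<close> has no constant term.
\<close>

lemma geom_bounded_b_series: "geom_bounded (\<lambda>n. norm (fps_nth b_series n))"
proof -
  define h :: "complex fps" where "h = (fps_exp (1/2) - fps_exp (- 1/2)) / fps_X - 1"
  have h: "fps_nth h n = ((1/2) ^ Suc n - (- 1/2) ^ Suc n) / fact (Suc n) - (if n = 0 then 1 else 0)" for n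
  proof -
    define f :: "complex fps" where "f = fps_exp (1/2) - fps_exp (- 1/2)"
    have "f = fps_shift 1 f * fps_X"
      by (rule fps_ext) (simp add: f_def)
    then have "f / fps_X = fps_shift 1 f"
      by (metis fps_X_neq_zero nonzero_mult_div_cancel_right)
    then show ?thesis
      unfolding h_def f_def[symmetric] by (simp add: f_def diff_divide_distrib del: power_Suc fact_Suc)
  qed
  have h0: "fps_nth h 0 = 0" by (simp add: h)
  have h1: "norm (fps_nth h n) \<le> 1 ^ n" if "n > 0" for n
  proof -
    have "norm (fps_nth h n) = norm ((1/2::complex) ^ Suc n - (- 1/2) ^ Suc n) / fact (Suc n)"
      using that by (simp add: h norm_divide norm_fact del: power_Suc fact_Suc)
    also have "\<dots> \<le> (norm ((1/2::complex) ^ Suc n) + norm ((- 1/2 :: complex) ^ Suc n)) / 1"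
      by (intro frac_le norm_triangle_ineq4 add_nonneg_nonneg norm_ge_zero fact_ge_1) auto
    also have "\<dots> = 2 * (1/2) ^ Suc n" by (simp add: norm_power norm_divide)
    also have "\<dots> \<le> 1" by (simp add: power_le_one)
    finally show ?thesis by simp
  qed
  have pow: "norm (fps_nth (h ^ k) n) \<le> (2 * 1) ^ n" for k n
  proof (rule iterated_convolution_le[where u = "\<lambda>n. norm (fps_nth h n)"
        and v = "\<lambda>k n. norm (fps_nth (h ^ k) n)"])
    fix k n
    have "norm (fps_nth (h ^ Suc k) n) \<le> (\<Sum>i=0..n. norm (fps_nth h i * fps_nth (h ^ k) (n - i)))"
      by (simp add: fps_mult_nth sum_norm_le)
    then show "norm (fps_nth (h ^ Suc k) n) \<le> (\<Sum>i\<le>n. norm (fps_nth h i) * norm (fps_nth (h ^ k) (n - i)))"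
      by (simp add: norm_mult atLeast0AtMost)
  qed (use h0 h1 in auto)
  have ln: "norm (fps_nth (fps_ln (1::complex)) k) \<le> 1" for k
  proof (cases k)
    case (Suc j)
    have "norm (fps_nth (fps_ln (1::complex)) k) = 1 / real (Suc j)"
      using Suc by (simp add: fps_ln_def norm_divide norm_power del: of_nat_Suc)
    then show ?thesis by simp
  qed (simp add: fps_ln_def)
  have "norm (fps_nth b_series n) \<le> 1 * 4 ^ n" for n
  proof -
    have "norm (fps_nth b_series n) \<le> norm (fps_nth (fps_compose (fps_ln 1) h) n)"
      unfolding b_series_def h_def by (simp add: norm_mult)
    also have "\<dots> \<le> (\<Sum>k=0..n. norm (fps_nth (fps_ln (1::complex)) k) * norm (fps_nth (h ^ k) n))"
      unfolding fps_compose_nth by (rule order_trans[OF norm_sum]) (simp add: norm_mult)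
    also have "\<dots> \<le> (\<Sum>k=0..n. 1 * (2 * 1) ^ n)"
      by (intro sum_mono mult_mono pow ln) auto
    also have "\<dots> = real (Suc n) * 2 ^ n" by (simp add: algebra_simps)
    also have "\<dots> \<le> 2 ^ n * 2 ^ n"
      by (rule mult_right_mono) (auto intro: Suc_le_two_power)
    also have "\<dots> = 4 ^ n" by (subst power_mult_distrib[symmetric]) simp
    finally show ?thesis by simp
  qed
  then show ?thesis by (rule geom_boundedI)
qed

lemma geom_bounded_wheels_exp:
  assumes "norm r \<le> 1"
  shows "geom_bounded_series (wheels_exp r)"
  unfolding wheels_exp_def
proof (rule geom_bounded_power_sum)
  show "geom_bounded_series (\<lambda>n. if even n \<and> n > 0 then Poly_Mapping.single (wheel n) (r * fps_nth b_series n) else 0)"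
    using geom_bounded_b_series
    by (rule geom_bounded_mono) (auto simp: norm_mult intro!: mult_left_le_one_le assms)
qed (auto simp: norm_divide norm_fact divide_le_eq_1 fact_ge_1)

text \<open>
  Symmetrization is an average over \<open>k!\<close> ways of gluing, each with weight \<open>1 / k!\<close>.
\<close>

lemma l1_chi_diag: "l1 (chi_diag D) \<le> 1"
proof -
  let ?k = "length (labs D)"
  have "l1 (chi_diag D) \<le> (\<Sum>\<sigma> | \<sigma> permutes {..<?k}. norm (1 / fact ?k :: complex))"
    unfolding chi_diag_def by (rule order_trans[OF l1_sum]) simp
  also have "\<dots> = 1" by (simp add: norm_divide norm_fact card_permutations)
  finally show ?thesis .
qed

lemma geom_bounded_chi: "geom_bounded_series z \<Longrightarrow> geom_bounded_series (chi z)"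
  unfolding chi_def
  by (erule geom_bounded_mono) (use l1_linext[of chi_diag 1, OF l1_chi_diag] in simp)

text \<open>
  The quotient of consecutive binomial coefficients is \<open>(1/2 - k) / (k + 1)\<close>.
\<close>

lemma norm_half_gchoose_le_1: "norm ((1/2::complex) gchoose k) \<le> 1"
proof (induction k)
  case (Suc k)
  have "(1/2::complex) gchoose Suc k = (1/2 gchoose k) * ((1/2 - of_nat k) / of_nat (Suc k))"
    by (simp add: gbinomial_prod_rev ac_simps del: of_nat_Suc)
  moreover have "norm ((1/2 - of_nat k) / of_nat (Suc k) :: complex) \<le> 1"
  proof -
    have "(1/2 - of_nat k :: complex) = of_real (1/2 - real k)" by simp
    then have "norm (1/2 - of_nat k :: complex) = \<bar>1/2 - real k\<bar>"
      by (simp only: norm_of_real)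
    also have "\<dots> \<le> real (Suc k)" by simp
    finally show ?thesis by (simp only: norm_divide norm_of_nat) (simp add: divide_le_eq_1)
  qed
  ultimately show ?case using Suc by (simp only: norm_mult mult_le_one norm_ge_zero)
qed simp

lemma geom_bounded_sqrt_nu_union: "geom_bounded_series sqrt_nu_union"
  unfolding sqrt_nu_union_def by (intro geom_bounded_chi geom_bounded_wheels_exp) (simp add: norm_divide)

lemma geom_bounded_sqrt_nu_stack: "geom_bounded_series sqrt_nu_stack"
  unfolding sqrt_nu_stack_def
proof (rule geom_bounded_power_sum)
  show "geom_bounded_series (\<lambda>n. if n = 0 then 0 else chi (wheels_exp 1) n)"
    using geom_bounded_chi[OF geom_bounded_wheels_exp[of 1]]
    by (rule geom_bounded_mono) auto
qed (auto simp: norm_half_gchoose_le_1)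

section \<open>Noncommutative power series\<close>

lemma nc_mult_Nil: "nc_mult f g [] = f [] * g []"
  by (simp add: nc_mult_def)

text \<open>
  Splitting off the first letter turns statements about products into inductions on the word in
  which the left factor varies.
\<close>

lemma nc_mult_Cons: "nc_mult f g (x # w) = f [] * g (x # w) + nc_mult (\<lambda>v. f (x # v)) g w"
  unfolding nc_mult_def by (simp add: sum.atMost_Suc_shift del: sum.atMost_Suc)

lemma nc_mult_add_left: "nc_mult (\<lambda>v. f v + g v) h w = nc_mult f h w + nc_mult g h w"
  by (simp add: nc_mult_def distrib_right sum.distrib)

lemma nc_mult_diff_left: "nc_mult (\<lambda>v. f v - g v) h w = nc_mult f h w - nc_mult g h w"
  by (simp add: nc_mult_def left_diff_distrib sum_subtractf)

lemma nc_mult_scale_left: "nc_mult (\<lambda>v. c * f v) g w = c * nc_mult f g w"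
  by (simp add: nc_mult_def sum_distrib_left mult.assoc)

lemma nc_mult_scale_right: "nc_mult f (\<lambda>v. c * g v) w = c * nc_mult f g w"
  by (simp add: nc_mult_def sum_distrib_left mult.left_commute)

lemma nc_mult_assoc: "nc_mult (nc_mult f g) h = nc_mult f (nc_mult g h)"
proof
  fix w show "nc_mult (nc_mult f g) h w = nc_mult f (nc_mult g h) w"
  proof (induction w arbitrary: f g)
    case (Cons x w)
    have "nc_mult (nc_mult f g) h (x # w)
        = f [] * (g [] * h (x # w) + nc_mult (\<lambda>v. g (x # v)) h w)
          + nc_mult (nc_mult (\<lambda>v. f (x # v)) g) h w"
      by (simp add: nc_mult_Nil nc_mult_Cons nc_mult_add_left nc_mult_scale_left distrib_left)
    also have "\<dots> = nc_mult f (nc_mult g h) (x # w)"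
      by (simp add: nc_mult_Cons Cons.IH)
    finally show ?case .
  qed (simp add: nc_mult_Nil)
qed

lemma nc_mult_zero_left: "nc_mult (\<lambda>v. 0) g w = 0"
  by (simp add: nc_mult_def)

lemma nc_mult_one_left [simp]: "nc_mult nc_one f = f"
proof
  fix w show "nc_mult nc_one f w = f w"
    by (cases w) (simp_all add: nc_mult_Nil nc_mult_Cons nc_mult_zero_left nc_one_def)
qed

lemma nc_mult_letter_left:
  "nc_mult (nc_letter l) f w = (case w of [] \<Rightarrow> 0 | x # v \<Rightarrow> if x = l then f v else 0)"
proof (cases w)
  case (Cons x v)
  have "(\<lambda>v. nc_letter l (x # v)) = (if x = l then nc_one else (\<lambda>v. 0))"
    by (auto simp: nc_letter_def nc_one_def)
  then show ?thesis using Cons by (simp add: nc_mult_Cons nc_mult_zero_left) (simp add: nc_letter_def)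
qed (simp add: nc_mult_Nil nc_letter_def)

lemma nc_mult_letter_right:
  "nc_mult f (nc_letter l) w = (if w \<noteq> [] \<and> last w = l then f (butlast w) else 0)"
proof (induction w arbitrary: f)
  case (Cons x w)
  then show ?case by (auto simp: nc_mult_Cons nc_letter_def)
qed (simp add: nc_mult_Nil nc_letter_def)

lemma nc_mult_one_right [simp]: "nc_mult f nc_one = f"
proof
  fix w show "nc_mult f nc_one w = f w"
    by (induction w arbitrary: f) (simp_all add: nc_mult_Nil nc_mult_Cons, simp_all add: nc_one_def)
qed

lemma nc_mult_exp_neg: "nc_mult (nc_exp l c) (nc_exp l (- c)) = nc_one"
proof
  fix w show "nc_mult (nc_exp l c) (nc_exp l (- c)) w = nc_one w"
  proof (cases "set w \<subseteq> {l}")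
    case True
    let ?n = "length w"
    have sub: "set (take i w) \<subseteq> {l}" "set (drop i w) \<subseteq> {l}" for i
      using True set_take_subset[of i w] set_drop_subset[of i w] by blast+
    have "nc_mult (nc_exp l c) (nc_exp l (- c)) w
        = (\<Sum>i\<le>?n. c ^ i / fact i * ((- c) ^ (?n - i) / fact (?n - i)))"
      unfolding nc_mult_def using sub by (intro sum.cong) (simp_all add: nc_exp_def min_def)
    also have "\<dots> = (\<Sum>i\<le>?n. of_nat (?n choose i) * c ^ i * (- c) ^ (?n - i)) / fact ?n"
      unfolding sum_divide_distrib by (intro sum.cong) (simp_all add: binomial_fact)
    also have "\<dots> = (c + - c) ^ ?n / fact ?n"
      by (subst binomial_ring) simp
    also have "\<dots> = nc_one w" by (cases w) (simp_all add: nc_one_def)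
    finally show ?thesis .
  next
    case False
    have "nc_exp l c (take i w) * nc_exp l (- c) (drop i w) = 0" for i
    proof -
      have "set w = set (take i w) \<union> set (drop i w)"
        by (metis append_take_drop_id set_append)
      with False show ?thesis by (auto simp: nc_exp_def)
    qed
    then have "nc_mult (nc_exp l c) (nc_exp l (- c)) w = 0"
      unfolding nc_mult_def by (intro sum.neutral ballI)
    moreover have "w \<noteq> []" using False by auto
    ultimately show ?thesis by (simp add: nc_one_def)
  qed
qed

section \<open>Inverses of noncommutative power series\<close>

text \<open>
  The recursion solves \<open>f g = 1\<close> for \<open>g\<close> when \<open>f\<close> has constant term 1. It is needed because
  \<open>nc_inverse\<close> is a definite description, which says nothing until existence and uniqueness of a
  two-sided inverse are known.
\<close>

function nc_right_inverse :: "nc_series \<Rightarrow> nc_series" where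
  "nc_right_inverse f w = nc_one w - (\<Sum>i=1..length w. f (take i w) * nc_right_inverse f (drop i w))"
  by auto
termination by (relation "Wellfounded.measure (\<lambda>(f, w). length w)") auto

declare nc_right_inverse.simps [simp del]

lemma nc_mult_split_left:
  "nc_mult f g w = f [] * g w + (\<Sum>i=1..length w. f (take i w) * g (drop i w))"
  unfolding nc_mult_def by (simp add: sum.atMost_shift sum.atLeast1_atMost_eq)

lemma nc_mult_right_inverse:
  assumes "f [] = 1"
  shows "nc_mult f (nc_right_inverse f) = nc_one"
  by (rule ext, subst nc_mult_split_left, subst nc_right_inverse.simps) (simp add: assms)

text \<open>
  A right inverse \<open>g\<close> of \<open>f\<close> has itself a right inverse \<open>h\<close>, and \<open>f = f (g h) = (f g) h = h\<close> shows that
  \<open>g\<close> is two-sided.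
\<close>

lemma
  assumes "f [] = 1"
  shows nc_inverse_right: "nc_mult f (nc_inverse f) = nc_one"
    and nc_inverse_left: "nc_mult (nc_inverse f) f = nc_one"
    and nc_inverse_eq_right_inverse: "nc_inverse f = nc_right_inverse f"
proof -
  let ?g = "nc_right_inverse f"
  have fg: "nc_mult f ?g = nc_one" by (rule nc_mult_right_inverse) (rule assms)
  have g1: "?g [] = 1" by (subst nc_right_inverse.simps) (simp add: nc_one_def)
  let ?h = "nc_right_inverse ?g"
  have gh: "nc_mult ?g ?h = nc_one" by (rule nc_mult_right_inverse) (rule g1)
  have "f = nc_mult f (nc_mult ?g ?h)" by (simp add: gh)
  also have "\<dots> = ?h" by (simp add: fg flip: nc_mult_assoc)
  finally have "f = ?h" .
  then have gf: "nc_mult ?g f = nc_one" using gh by simp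
  have "g' = ?g" if "nc_mult f g' = nc_one" for g'
  proof -
    have "g' = nc_mult (nc_mult ?g f) g'" by (simp add: gf)
    also have "\<dots> = ?g" by (simp add: nc_mult_assoc that)
    finally show ?thesis .
  qed
  then have eq: "nc_inverse f = ?g"
    unfolding nc_inverse_def using fg gf by (intro the_equality conjI) blast+
  show "nc_inverse f = ?g" by (rule eq)
  show "nc_mult f (nc_inverse f) = nc_one" unfolding eq by (rule fg)
  show "nc_mult (nc_inverse f) f = nc_one" unfolding eq by (rule gf)
qed

section \<open>Geometric bounds on noncommutative power series\<close>

definition nc_geom_bounded :: "nc_series \<Rightarrow> bool" where
  "nc_geom_bounded f \<longleftrightarrow> (\<exists>u. geom_bounded u \<and> (\<forall>w. norm (f w) \<le> u (length w)))"

lemma nc_geom_bounded_mult: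
  assumes "nc_geom_bounded f" "nc_geom_bounded g"
  shows "nc_geom_bounded (nc_mult f g)"
proof -
  obtain u v where u: "geom_bounded u" "\<And>w. norm (f w) \<le> u (length w)"
    and v: "geom_bounded v" "\<And>w. norm (g w) \<le> v (length w)"
    using assms unfolding nc_geom_bounded_def by metis
  have u0: "0 \<le> u n" for n
    using order_trans[OF norm_ge_zero u(2)[of "replicate n True"]] by simp
  have v0: "0 \<le> v n" for n
    using order_trans[OF norm_ge_zero v(2)[of "replicate n True"]] by simp
  have "norm (nc_mult f g w) \<le> (\<Sum>i\<le>length w. u i * v (length w - i))" for w
  proof -
    have "norm (nc_mult f g w) \<le> (\<Sum>i\<le>length w. norm (f (take i w)) * norm (g (drop i w)))"
      unfolding nc_mult_def by (rule order_trans[OF norm_sum]) (simp add: norm_mult)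
    also have "\<dots> \<le> (\<Sum>i\<le>length w. u i * v (length w - i))"
    proof (intro sum_mono mult_mono)
      fix i assume "i \<in> {..length w}"
      then show "norm (f (take i w)) \<le> u i" using u(2)[of "take i w"] by (simp add: min_absorb2)
      show "norm (g (drop i w)) \<le> v (length w - i)" using v(2)[of "drop i w"] by simp
    qed (auto simp: u0)
    finally show ?thesis .
  qed
  with geom_bounded_convolution[OF u(1) v(1) u0 v0] show ?thesis
    unfolding nc_geom_bounded_def by (intro exI conjI allI)
qed

text \<open>
  In the recursion for the inverse every term splits off a nonempty word, so \<open>sum_geometric_le\<close>
  carries the bound \<open>(2 C) ^ n\<close> from shorter words to longer ones.
\<close>

lemma nc_geom_bounded_inverse:
  assumes "nc_geom_bounded f" "f [] = 1"
  shows "nc_geom_bounded (nc_inverse f)"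
proof -
  obtain u where u: "geom_bounded u" "\<And>w. norm (f w) \<le> u (length w)"
    using assms unfolding nc_geom_bounded_def by metis
  obtain C where C: "C \<ge> 1" "\<And>n. n > 0 \<Longrightarrow> u n \<le> C ^ n"
    using geom_boundedE_pos[OF u(1)] by metis
  have "norm (nc_right_inverse f w) \<le> (2 * C) ^ length w" for w
  proof (induction w rule: length_induct)
    case (1 w)
    show ?case
    proof (cases "w = []")
      case True
      then show ?thesis by (subst nc_right_inverse.simps) (simp add: nc_one_def)
    next
      case False
      then have "norm (nc_right_inverse f w)
          = norm (\<Sum>i=1..length w. f (take i w) * nc_right_inverse f (drop i w))"
        by (subst nc_right_inverse.simps) (simp add: nc_one_def)
      also have "\<dots> \<le> (\<Sum>i=1..length w. norm (f (take i w)) * norm (nc_right_inverse f (drop i w)))"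
        by (rule order_trans[OF norm_sum]) (simp add: norm_mult)
      also have "\<dots> \<le> (\<Sum>i=1..length w. C ^ i * (2 * C) ^ (length w - i))"
      proof (intro sum_mono mult_mono)
        fix i assume i: "i \<in> {1..length w}"
        then have "norm (f (take i w)) \<le> u i" using u(2)[of "take i w"] by (simp add: min_absorb2)
        also have "\<dots> \<le> C ^ i" using i by (intro C) auto
        finally show "norm (f (take i w)) \<le> C ^ i" .
        show "norm (nc_right_inverse f (drop i w)) \<le> (2 * C) ^ (length w - i)"
          using 1[rule_format, of "drop i w"] i by auto
      qed (use C in auto)
      also have "\<dots> \<le> (2 * C) ^ length w" using C by (intro sum_geometric_le) auto
      finally show ?thesis .
    qed
  qed
  moreover have "geom_bounded (\<lambda>n. (2 * C) ^ n)"
    by (rule geom_boundedI[where M = 1 and C = "2 * C"]) simp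
  ultimately show ?thesis
    unfolding nc_geom_bounded_def nc_inverse_eq_right_inverse[of f, OF assms(2)]
    by (intro exI[of _ "\<lambda>n. (2 * C) ^ n"]) auto
qed

lemma nc_geom_bounded_exp: "nc_geom_bounded (nc_exp l c)"
proof -
  have "geom_bounded (\<lambda>n. norm c ^ n)"
    by (rule geom_boundedI[where M = 1 and C = "norm c"]) simp
  moreover have "norm (nc_exp l c w) \<le> norm c ^ length w" for w
    using fact_ge_1[of "length w", where ?'a = real]
    by (auto simp: nc_exp_def norm_divide norm_power norm_fact divide_le_eq mult_le_cancel_left1)
  ultimately show ?thesis unfolding nc_geom_bounded_def by (intro exI conjI allI)
qed

section \<open>The regular factor of a solution of the KZ equation\<close>

definition kz_const :: complex where "kz_const = 1 / (2 * of_real pi * \<i>)"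

lemma norm_kz_const_le: "norm kz_const \<le> 1 / 3"
  using pi_ge_two by (simp add: kz_const_def norm_divide norm_mult field_simps)

text \<open>
  The coefficient of \<open>z ^ n\<close> in the regular factor \<open>P\<close> of the solution \<open>P z \<cdot> z^(A/2\<pi>i)\<close>. With
  \<open>\<kappa> = 1/2\<pi>i\<close> the KZ equation becomes \<open>z P' = \<kappa> (A P - P A + z/(z - 1) B P)\<close>; since
  \<open>z/(z - 1) = - (z + z\<^sup>2 + \<dots>)\<close>, comparing coefficients gives the recursion, where the letter
  \<open>A\<close> is removed at either end and \<open>B\<close> at the front of the word.
\<close>

function kz_coeff :: "nat \<Rightarrow> nc_series" where
  "kz_coeff n [] = (if n = 0 then 1 else 0)"
| "kz_coeff n (l # w) = (if n = 0 then 0 else kz_const / of_nat n *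
     ((if l then kz_coeff n w else - (\<Sum>j<n. kz_coeff j w))
      - (if last (l # w) then kz_coeff n (butlast (l # w)) else 0)))"
  by pat_completeness auto
termination by (relation "Wellfounded.measure (\<lambda>(n, w). length w)") auto

declare kz_coeff.simps(2) [simp del]

lemma kz_coeff_0: "kz_coeff 0 = nc_one"
proof
  show "kz_coeff 0 w = nc_one w" for w by (cases w) (simp_all add: nc_one_def kz_coeff.simps(2))
qed

text \<open>
  The same recursion without a case distinction on the word, in the form in which it is summed over
  \<open>n\<close>.
\<close>

lemma kz_coeff_recurrence:
  "of_nat n * kz_coeff n w = kz_const * (nc_mult (nc_letter True) (kz_coeff n) w
     - nc_mult (kz_coeff n) (nc_letter True) w
     - (\<Sum>j<n. nc_mult (nc_letter False) (kz_coeff j) w))"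
proof (cases "n = 0")
  case True
  then show ?thesis
    by (simp add: kz_coeff_0 nc_mult_one_left nc_mult_one_right)
next
  case False
  then show ?thesis
  proof (cases w)
    case (Cons l v)
    show ?thesis unfolding Cons
      by (subst (1) kz_coeff.simps(2)) (use False in \<open>simp add: nc_mult_letter_left nc_mult_letter_right\<close>)
  qed (simp add: nc_mult_letter_left nc_mult_letter_right)
qed

text \<open>
  The recursion involves at most \<open>n + 1\<close> coefficients at shorter words. The factor \<open>\<kappa>/n\<close> compensates
  for this, as \<open>(n + 1) / 3 n \<le> 1\<close> for \<open>n \<ge> 1\<close>.
\<close>

lemma norm_kz_coeff_le: "norm (kz_coeff n w) \<le> 1"
proof (induction w arbitrary: n rule: length_induct)
  case (1 w)
  show ?case
  proof (cases "w = [] \<or> n = 0")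
    case True
    then show ?thesis by (cases w) (auto simp: kz_coeff_0 nc_one_def)
  next
    case False
    then obtain l v where w: "w = l # v" by (cases w) auto
    have "length v < length w" "length (butlast w) < length w" by (simp_all add: w)
    then have IH: "norm (kz_coeff j v) \<le> 1" "norm (kz_coeff j (butlast w)) \<le> 1" for j
      using 1 by blast+
    have sum: "norm (\<Sum>j<n. kz_coeff j v) \<le> n"
      using sum_norm_le[of "{..<n}" "\<lambda>j. kz_coeff j v" "\<lambda>_. 1"] IH by simp
    let ?a = "if l then kz_coeff n v else - (\<Sum>j<n. kz_coeff j v)"
    let ?b = "if last w then kz_coeff n (butlast w) else 0"
    have "norm (?a - ?b) \<le> norm ?a + norm ?b" by (rule norm_triangle_ineq4)
    also have "\<dots> \<le> real n + 1"
      by (rule add_mono) (use sum IH(1)[of n] IH(2)[of n] False in auto)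
    finally have ab: "norm (?a - ?b) \<le> real n + 1" .
    have "norm (kz_coeff n w) = norm kz_const / n * norm (?a - ?b)"
      unfolding w by (subst kz_coeff.simps(2)) (use False in \<open>simp add: norm_mult norm_divide\<close>)
    also have "\<dots> \<le> (1 / 3) / n * (real n + 1)"
      by (intro mult_mono divide_right_mono norm_kz_const_le ab) auto
    also have "\<dots> \<le> 1" using False by (simp add: field_simps)
    finally show ?thesis .
  qed
qed

definition kz_regular :: "real \<Rightarrow> nc_series" where
  "kz_regular z w = (suminf (\<lambda>n. kz_coeff n w * of_real z ^ n))"

lemma summable_bounded_powser:
  fixes c :: "nat \<Rightarrow> complex"
  assumes "\<And>n. norm (c n) \<le> 1" "norm x < 1"
  shows "summable (\<lambda>n. c n * x ^ n)"
proof (rule summable_comparison_test)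
  show "\<exists>N. \<forall>n\<ge>N. norm (c n * x ^ n) \<le> norm x ^ n"
    using assms by (auto simp: norm_mult norm_power intro!: mult_left_le_one_le)
  show "summable (\<lambda>n. norm x ^ n)" using assms by (intro summable_geometric) simp
qed

lemma kz_regular_sums:
  assumes "\<bar>z\<bar> < 1"
  shows "(\<lambda>n. kz_coeff n w * of_real z ^ n) sums kz_regular z w"
  unfolding kz_regular_def using assms
  by (intro summable_sums summable_bounded_powser norm_kz_coeff_le) auto

lemma nc_mult_sums:
  fixes p :: "nat \<Rightarrow> nc_series"
  assumes "\<And>v. (\<lambda>n. p n v * x n) sums P v"
  shows "(\<lambda>n. nc_mult (p n) g w * x n) sums nc_mult P g w"
    and "(\<lambda>n. nc_mult g (p n) w * x n) sums nc_mult g P w"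
proof -
  have "(\<lambda>n. \<Sum>i\<le>length w. (p n (take i w) * x n) * g (drop i w)) sums nc_mult P g w"
    unfolding nc_mult_def by (intro sums_sum sums_mult2 assms)
  then show "(\<lambda>n. nc_mult (p n) g w * x n) sums nc_mult P g w"
    by (simp add: nc_mult_def sum_distrib_left mult_ac)
  have "(\<lambda>n. \<Sum>i\<le>length w. g (take i w) * (p n (drop i w) * x n)) sums nc_mult g P w"
    unfolding nc_mult_def by (intro sums_sum sums_mult assms)
  then show "(\<lambda>n. nc_mult g (p n) w * x n) sums nc_mult g P w"
    by (simp add: nc_mult_def sum_distrib_left mult_ac)
qed

text \<open>
  Multiplication by \<open>x / (1 - x)\<close> replaces the coefficients of a power series by their partial sums.
\<close>

lemma partial_sums_sums:
  fixes h :: "nat \<Rightarrow> complex"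
  assumes h: "\<And>n. norm (h n) \<le> 1" and x: "norm x < 1" and H: "(\<lambda>n. h n * x ^ n) sums H"
  shows "(\<lambda>n. (\<Sum>j<n. h j) * x ^ n) sums (x * H / (1 - x))"
proof -
  have "summable (\<lambda>n. (\<Sum>j<n. h j) * x ^ n)"
  proof (rule summable_comparison_test)
    show "\<exists>N. \<forall>n\<ge>N. norm ((\<Sum>j<n. h j) * x ^ n) \<le> of_nat (Suc n) * norm x ^ n"
    proof (intro exI allI impI)
      fix n
      have "norm (\<Sum>j<n. h j) \<le> n"
        using sum_norm_le[of "{..<n}" h "\<lambda>_. 1"] h by simp
      then have "norm (\<Sum>j<n. h j) \<le> real (Suc n)" by simp
      then show "norm ((\<Sum>j<n. h j) * x ^ n) \<le> real (Suc n) * norm x ^ n"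
        unfolding norm_mult norm_power by (rule mult_right_mono) simp
    qed
    show "summable (\<lambda>n. of_nat (Suc n) * norm x ^ n)"
      using x by (intro sums_summable[OF geometric_deriv_sums]) simp
  qed
  then obtain S where S: "(\<lambda>n. (\<Sum>j<n. h j) * x ^ n) sums S" by (auto simp: summable_def)
  have "(\<lambda>n. (\<Sum>j<Suc n. h j) * x ^ Suc n) sums S"
    using S by (subst sums_Suc_iff) simp
  moreover have "(\<lambda>n. x * ((\<Sum>j<n. h j) * x ^ n + h n * x ^ n)) sums (x * (S + H))"
    by (intro sums_mult sums_add S H)
  then have "(\<lambda>n. (\<Sum>j<Suc n. h j) * x ^ Suc n) sums (x * (S + H))"
    by (simp add: algebra_simps)
  ultimately have "S = x * (S + H)" by (rule sums_unique2)
  moreover have "x \<noteq> 1" using x by auto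
  ultimately have "S = x * H / (1 - x)" by (simp add: field_simps)
  then show ?thesis using S by simp
qed

text \<open>
  The recursion for the coefficients, summed up: the equation \<open>z P' = \<kappa> (A P - P A + z/(z - 1) B P)\<close>.
\<close>

lemma kz_regular_deriv:
  assumes z: "0 < z" "z < 1"
  shows "((\<lambda>t. kz_regular t w) has_vector_derivative
    kz_const * (nc_mult (nc_letter True) (kz_regular z) w / of_real z
      - nc_mult (kz_regular z) (nc_letter True) w / of_real z
      + nc_mult (nc_letter False) (kz_regular z) w / of_real (z - 1))) (at z)"
proof -
  let ?x = "of_real z :: complex"
  let ?c = "\<lambda>n. kz_coeff n w"
  have x: "norm ?x < 1" "?x \<noteq> 0" "?x \<noteq> 1" using z by auto
  define A B C where "A = nc_mult (nc_letter True) (kz_regular z) w"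
    and "B = nc_mult (kz_regular z) (nc_letter True) w"
    and "C = nc_mult (nc_letter False) (kz_regular z) w"
  have deriv: "((\<lambda>x. suminf (\<lambda>n. ?c n * x ^ n)) has_field_derivative (suminf (\<lambda>n. diffs ?c n * ?x ^ n))) (at ?x)"
    by (rule termdiffs_strong'[of 1]) (use x in \<open>auto intro: summable_bounded_powser norm_kz_coeff_le\<close>)
  have dsum: "summable (\<lambda>n. diffs ?c n * ?x ^ n)"
    by (rule termdiff_converges[of _ 1]) (use x in \<open>auto intro: summable_bounded_powser norm_kz_coeff_le\<close>)
  have loc: "\<And>v. (\<lambda>n. kz_coeff n v * ?x ^ n) sums kz_regular z v"
    using z by (intro kz_regular_sums) auto
  have "(\<lambda>n. (\<Sum>j<n. nc_mult (nc_letter False) (kz_coeff j) w) * ?x ^ n) sums (?x * C / (1 - ?x))"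
    unfolding C_def
  proof (rule partial_sums_sums)
    show "norm (nc_mult (nc_letter False) (kz_coeff n) w) \<le> 1" for n
      by (auto simp: nc_mult_letter_left norm_kz_coeff_le split: list.split)
  qed (use x nc_mult_sums(2)[OF loc] in auto)
  then have "(\<lambda>n. kz_const * (nc_mult (nc_letter True) (kz_coeff n) w * ?x ^ n
      - nc_mult (kz_coeff n) (nc_letter True) w * ?x ^ n
      - (\<Sum>j<n. nc_mult (nc_letter False) (kz_coeff j) w) * ?x ^ n))
      sums (kz_const * (A - B - ?x * C / (1 - ?x)))"
    unfolding A_def B_def by (intro sums_mult sums_diff nc_mult_sums loc)
  then have s1: "(\<lambda>n. of_nat n * ?c n * ?x ^ n) sums (kz_const * (A - B - ?x * C / (1 - ?x)))"
    unfolding kz_coeff_recurrence by (simp add: algebra_simps)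
  have "(\<lambda>n. of_nat (Suc n) * ?c (Suc n) * ?x ^ Suc n) sums (kz_const * (A - B - ?x * C / (1 - ?x)))"
    using s1 by (subst sums_Suc_iff) simp
  moreover have "(\<lambda>n. ?x * (diffs ?c n * ?x ^ n)) sums (?x * (suminf (\<lambda>n. diffs ?c n * ?x ^ n)))"
    by (intro sums_mult summable_sums dsum)
  then have "(\<lambda>n. of_nat (Suc n) * ?c (Suc n) * ?x ^ Suc n) sums (?x * (suminf (\<lambda>n. diffs ?c n * ?x ^ n)))"
    by (simp add: diffs_def mult_ac)
  ultimately have "?x * (suminf (\<lambda>n. diffs ?c n * ?x ^ n)) = kz_const * (A - B - ?x * C / (1 - ?x))"
    by (rule sums_unique2[rotated])
  then have "(suminf (\<lambda>n. diffs ?c n * ?x ^ n)) = kz_const * (A - B - ?x * C / (1 - ?x)) / ?x"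
    using x by (simp add: field_simps)
  also have "\<dots> = kz_const * (A / ?x - B / ?x + C / of_real (z - 1))"
    using x by (simp add: divide_simps) (simp add: algebra_simps)
  finally show ?thesis
    using has_vector_derivative_real_field[OF deriv, of UNIV]
    unfolding kz_regular_def[abs_def] A_def[symmetric] B_def[symmetric] C_def[symmetric]
    by (simp add: A_def B_def C_def kz_regular_def[abs_def])
qed

lemma kz_regular_tendsto: "((\<lambda>z. kz_regular z w) \<longlongrightarrow> nc_one w) (at_right 0)"
proof -
  have "((\<lambda>x. suminf (\<lambda>n. kz_coeff n w * x ^ n)) has_field_derivative
      (suminf (\<lambda>n. diffs (\<lambda>n. kz_coeff n w) n * (of_real 0) ^ n))) (at (of_real 0 :: complex))"
    by (rule termdiffs_strong'[of 1]) (auto intro: summable_bounded_powser norm_kz_coeff_le)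
  from has_vector_derivative_real_field[OF this, of UNIV]
  have "continuous (at 0) (\<lambda>z. kz_regular z w)"
    unfolding kz_regular_def by (rule has_vector_derivative_continuous)
  then have "((\<lambda>z. kz_regular z w) \<longlongrightarrow> kz_regular 0 w) (at 0)" by (simp add: continuous_at)
  moreover have "kz_regular 0 w = nc_one w" by (simp add: kz_regular_def kz_coeff_0)
  ultimately show ?thesis by (metis tendsto_within_subset subset_UNIV)
qed

lemma nc_mult_has_vector_derivative:
  assumes F: "\<And>v. ((\<lambda>t. F t v) has_vector_derivative F' v) (at z)"
    and G: "\<And>v. ((\<lambda>t. G t v) has_vector_derivative G' v) (at z)"
  shows "((\<lambda>t. nc_mult (F t) (G t) w) has_vector_derivative
    nc_mult F' (G z) w + nc_mult (F z) G' w) (at z)"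
proof -
  have "((\<lambda>t. \<Sum>i\<le>length w. F t (take i w) * G t (drop i w)) has_vector_derivative
      (\<Sum>i\<le>length w. F z (take i w) * G' (drop i w) + F' (take i w) * G z (drop i w))) (at z)"
    by (intro has_vector_derivative_sum has_vector_derivative_mult F G)
  then show ?thesis by (simp add: nc_mult_def sum.distrib add.commute)
qed

lemma nc_exp_Nil [simp]: "nc_exp l c [] = 1"
  by (simp add: nc_exp_def)

text \<open>
  This is \<open>d/dz z^(\<kappa> l) = (\<kappa>/z) l z^(\<kappa> l)\<close> for a letter \<open>l\<close>.
\<close>

lemma nc_exp_log_deriv:
  assumes "z > 0"
  shows "((\<lambda>t. nc_exp l (k * of_real (ln t)) v) has_vector_derivative
    k / of_real z * nc_mult (nc_letter l) (nc_exp l (k * of_real (ln z))) v) (at z)"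
proof (cases "set v \<subseteq> {l} \<and> v \<noteq> []")
  case True
  then obtain u where v: "v = l # u" "set u \<subseteq> {l}" by (cases v) auto
  let ?n = "length u"
  let ?c = "\<lambda>t. k * of_real (ln t)"
  have "((\<lambda>t. ln t) has_real_derivative 1 / z) (at z)"
    using assms by (auto intro!: derivative_eq_intros)
  then have "(?c has_vector_derivative k * of_real (1 / z)) (at z)"
    by (intro has_vector_derivative_mult_right has_vector_derivative_of_real)
       (simp add: has_real_derivative_iff_has_vector_derivative)
  moreover have "((\<lambda>y. y ^ Suc ?n / fact (Suc ?n)) has_field_derivative
      of_nat (Suc ?n) * ?c z ^ ?n / fact (Suc ?n)) (at (?c z))"
    by (auto intro!: derivative_eq_intros simp del: of_nat_Suc power_Suc fact_Suc)
  ultimately have "(((\<lambda>y. y ^ Suc ?n / fact (Suc ?n)) \<circ> ?c) has_vector_derivative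
      k * of_real (1 / z) * (of_nat (Suc ?n) * ?c z ^ ?n / fact (Suc ?n))) (at z)"
    by (rule field_vector_diff_chain_at)
  moreover have "of_nat (Suc ?n) * ?c z ^ ?n / fact (Suc ?n) = ?c z ^ ?n / fact ?n"
    unfolding fact_Suc by (simp del: of_nat_Suc)
  ultimately show ?thesis
    using v by (simp add: nc_exp_def nc_mult_letter_left o_def del: of_nat_Suc fact_Suc power_Suc)
next
  case False
  have "nc_mult (nc_letter l) (nc_exp l (k * of_real (ln z))) v = 0"
    using False by (auto simp: nc_mult_letter_left nc_exp_def split: list.split)
  moreover have "nc_exp l (k * of_real (ln t)) v = (if v = [] then 1 else 0)" for t
    using False by (cases "v = []") (simp_all add: nc_exp_def)
  ultimately show ?thesis by simp
qed

section \<open>The two normalized solutions of the KZ equation\<close>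

definition kz_sol0 :: "real \<Rightarrow> nc_series" where
  "kz_sol0 z = nc_mult (kz_regular z) (nc_exp True (kz_const * of_real (ln z)))"

text \<open>
  The substitution \<open>z \<mapsto> 1 - z\<close> exchanges the two singular terms of the KZ equation, and exchanging the
  letters exchanges them back.
\<close>

definition kz_sol1 :: "real \<Rightarrow> nc_series" where
  "kz_sol1 z w = kz_sol0 (1 - z) (map Not w)"

text \<open>
  The derivative of \<open>z^(\<kappa> A)\<close> cancels the term \<open>- P A\<close> in the derivative of the regular factor \<open>P\<close>.
\<close>

lemma kz_sol0_deriv:
  assumes z: "0 < z" "z < 1"
  shows "((\<lambda>t. kz_sol0 t w) has_vector_derivative
    kz_const * (nc_mult (nc_letter True) (kz_sol0 z) w / of_real z
      + nc_mult (nc_letter False) (kz_sol0 z) w / of_real (z - 1))) (at z)"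
proof -
  let ?A = "nc_letter True" and ?B = "nc_letter False"
  let ?P = "kz_regular z" and ?E = "nc_exp True (kz_const * of_real (ln z))"
  let ?a = "kz_const / of_real z" and ?b = "kz_const / of_real (z - 1)"
  have "((\<lambda>t. kz_sol0 t w) has_vector_derivative
      nc_mult (\<lambda>v. ?a * nc_mult ?A ?P v - ?a * nc_mult ?P ?A v + ?b * nc_mult ?B ?P v) ?E w
      + nc_mult ?P (\<lambda>v. ?a * nc_mult ?A ?E v) w) (at z)"
    unfolding kz_sol0_def
  proof (rule nc_mult_has_vector_derivative)
    show "((\<lambda>t. kz_regular t v) has_vector_derivative
        ?a * nc_mult ?A ?P v - ?a * nc_mult ?P ?A v + ?b * nc_mult ?B ?P v) (at z)" for v
      using kz_regular_deriv[OF z, of v] by (simp add: algebra_simps diff_divide_distrib)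
    show "((\<lambda>t. nc_exp True (kz_const * of_real (ln t)) v) has_vector_derivative
        ?a * nc_mult ?A ?E v) (at z)" for v
      using z by (intro nc_exp_log_deriv)
  qed
  also have "nc_mult (\<lambda>v. ?a * nc_mult ?A ?P v - ?a * nc_mult ?P ?A v + ?b * nc_mult ?B ?P v) ?E w
      + nc_mult ?P (\<lambda>v. ?a * nc_mult ?A ?E v) w
    = ?a * nc_mult ?A (kz_sol0 z) w + ?b * nc_mult ?B (kz_sol0 z) w"
    by (simp only: nc_mult_add_left nc_mult_diff_left nc_mult_scale_left nc_mult_scale_right
        nc_mult_assoc kz_sol0_def) simp
  finally show ?thesis by (simp add: algebra_simps)
qed

lemma solves_KZ_sol0: "solves_KZ kz_sol0"
  unfolding solves_KZ_def using kz_sol0_deriv by (simp add: kz_const_def)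

lemma map_Not_map_Not [simp]: "map Not (map Not w) = w"
  by (simp add: o_def)

lemma nc_mult_letter_map_Not:
  "nc_mult (nc_letter l) f (map Not w) = nc_mult (nc_letter (\<not> l)) (\<lambda>v. f (map Not v)) w"
  by (auto simp: nc_mult_letter_left split: list.split)

lemma solves_KZ_sol1: "solves_KZ kz_sol1"
  unfolding solves_KZ_def
proof (intro ballI allI)
  fix z :: real and w assume z: "z \<in> {0<..<1}"
  let ?D = "kz_const * (nc_mult (nc_letter True) (kz_sol0 (1 - z)) (map Not w) / of_real (1 - z)
      + nc_mult (nc_letter False) (kz_sol0 (1 - z)) (map Not w) / of_real (1 - z - 1))"
  have "((\<lambda>t. kz_sol0 t (map Not w)) has_vector_derivative ?D) (at (1 - z))"
    using z by (intro kz_sol0_deriv) auto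
  moreover have "((\<lambda>t. 1 - t) has_vector_derivative - 1) (at z)"
    by (auto intro!: derivative_eq_intros)
  ultimately have "(((\<lambda>t. kz_sol0 t (map Not w)) \<circ> (\<lambda>t. 1 - t)) has_vector_derivative (- 1) *\<^sub>R ?D) (at z)"
    by (intro vector_diff_chain_at) auto
  moreover have "(- 1) *\<^sub>R ?D = 1 / (2 * of_real pi * \<i>) *
      (nc_mult (nc_letter True) (kz_sol1 z) w / of_real z
       + nc_mult (nc_letter False) (kz_sol1 z) w / of_real (z - 1))"
    using z by (simp add: nc_mult_letter_map_Not kz_sol1_def[abs_def] kz_const_def divide_simps)
       (simp add: algebra_simps)
  ultimately show "((\<lambda>t. kz_sol1 t w) has_vector_derivative 1 / (2 * of_real pi * \<i>) *
      (nc_mult (nc_letter True) (kz_sol1 z) w / of_real z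
       + nc_mult (nc_letter False) (kz_sol1 z) w / of_real (z - 1))) (at z)"
    by (simp add: o_def kz_sol1_def[abs_def])
qed

lemma asymp_at_0_sol0: "asymp_at_0 kz_sol0"
  unfolding asymp_at_0_def
proof
  fix w
  have "nc_mult (kz_sol0 z) (nc_exp True (- of_real (ln z) / (2 * of_real pi * \<i>))) = kz_regular z" for z
  proof -
    have "- of_real (ln z) / (2 * of_real pi * \<i>) = - (kz_const * of_real (ln z))"
      by (simp add: kz_const_def)
    then show ?thesis
      by (simp only: kz_sol0_def nc_mult_assoc nc_mult_exp_neg nc_mult_one_right)
  qed
  then show "((\<lambda>z. nc_mult (kz_sol0 z) (nc_exp True (- of_real (ln z) / (2 * of_real pi * \<i>))) w)
      \<longlongrightarrow> nc_one w) (at_right 0)"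
    using kz_regular_tendsto by simp
qed

lemma asymp_at_1_sol1: "asymp_at_1 kz_sol1"
  unfolding asymp_at_1_def
proof
  fix w :: "bool list"
  let ?e = "\<lambda>l z. nc_exp l (- of_real (ln z) / (2 * of_real pi * \<i>))"
  have swap: "nc_exp False c v = nc_exp True c (map Not v)" for c v
    by (auto simp: nc_exp_def)
  have "nc_mult (kz_sol1 z) (?e False (1 - z)) w = nc_mult (kz_sol0 (1 - z)) (?e True (1 - z)) (map Not w)" for z
    by (simp add: nc_mult_def kz_sol1_def swap take_map drop_map)
  moreover have "((\<lambda>z. nc_mult (kz_sol0 (1 - z)) (?e True (1 - z)) (map Not w)) \<longlongrightarrow> nc_one (map Not w)) (at_left 1)"
  proof (rule filterlim_compose[where g = "\<lambda>z. nc_mult (kz_sol0 z) (?e True z) (map Not w)"])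
    show "((\<lambda>z. nc_mult (kz_sol0 z) (?e True z) (map Not w)) \<longlongrightarrow> nc_one (map Not w)) (at_right 0)"
      using asymp_at_0_sol0 unfolding asymp_at_0_def by blast
    have "((\<lambda>z. 1 - z) \<longlongrightarrow> 1 - 1) (at_left (1::real))" by (intro tendsto_intros)
    moreover have "eventually (\<lambda>z. 1 - z \<in> {0<..} \<and> 1 - z \<noteq> 0) (at_left (1::real))"
      by (rule eventually_at_leftI[of 0]) auto
    ultimately show "filterlim (\<lambda>z. 1 - z) (at_right 0) (at_left (1::real))"
      by (simp add: filterlim_at)
  qed
  moreover have "nc_one (map Not w) = nc_one w" by (simp add: nc_one_def)
  ultimately show "((\<lambda>z. nc_mult (kz_sol1 z) (?e False (1 - z)) w) \<longlongrightarrow> nc_one w) (at_left 1)"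
    by simp
qed

section \<open>Uniqueness of solutions of the KZ equation\<close>

text \<open>
  The derivative of the coefficient at \<open>w\<close> involves only the coefficient at the tail of \<open>w\<close>. If the
  coefficients at all shorter words agree, then the coefficients at \<open>w\<close> differ by a constant, and any
  normalization that forces this constant to vanish determines the solution.
\<close>

lemma solves_KZ_unique:
  assumes G: "solves_KZ G" and H: "solves_KZ H"
    and const: "\<And>w k. \<lbrakk>\<And>v z. length v < length w \<Longrightarrow> z \<in> {0<..<1} \<Longrightarrow> G z v = H z v;
       \<And>z. z \<in> {0<..<1} \<Longrightarrow> G z w - H z w = k\<rbrakk> \<Longrightarrow> k = 0"
    and z: "z \<in> {0<..<1}"
  shows "G z = H z"
proof
  fix w show "G z w = H z w"
    using z
  proof (induction w arbitrary: z rule: length_induct)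
    case (1 w)
    let ?D = "\<lambda>F y. 1 / (2 * of_real pi * \<i>) * (nc_mult (nc_letter True) (F y) w / of_real y
       + nc_mult (nc_letter False) (F y) w / of_real (y - 1))"
    have IH: "G y v = H y v" if "length v < length w" "y \<in> {0<..<1}" for v y
      using 1 that by blast
    have "((\<lambda>t. G t w - H t w) has_vector_derivative 0) (at y)" if y: "y \<in> {0<..<1}" for y
    proof -
      have "nc_mult (nc_letter l) (G y) w = nc_mult (nc_letter l) (H y) w" for l
        using IH[OF _ y] by (auto simp: nc_mult_letter_left split: list.split)
      moreover have "((\<lambda>t. G t w - H t w) has_vector_derivative ?D G y - ?D H y) (at y)"
        using G H y unfolding solves_KZ_def by (intro has_vector_derivative_diff) blast+
      ultimately show ?thesis by simp
    qed
    then have "((\<lambda>t. G t w - H t w) has_vector_derivative 0) (at y within {0<..<1})"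
      if "y \<in> {0<..<1}" for y
      using that by (blast intro: has_vector_derivative_at_within)
    then obtain k where k: "\<And>y. y \<in> {0<..<1} \<Longrightarrow> G y w - H y w = k"
      using has_vector_derivative_zero_constant[of "{0<..<1::real}" "\<lambda>t. G t w - H t w"] by auto
    have "k = 0" using const[OF IH k] .
    then show ?case using k[OF 1(2)] by simp
  qed
qed

lemma solves_KZ_unique_at:
  assumes "solves_KZ G" "solves_KZ H" "G y = H y" "y \<in> {0<..<1}" "z \<in> {0<..<1}"
  shows "G z = H z"
  using assms(1,2) _ assms(5)
proof (rule solves_KZ_unique)
  fix w k assume "\<And>z. z \<in> {0<..<1} \<Longrightarrow> G z w - H z w = k"
  from this[OF assms(4)] show "k = 0" using assms(3) by simp
qed

text \<open>
  The normalization by asymptotics does not require a rate of convergence, although the factor \<open>E\<close>, a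
  power of \<open>z\<close> or \<open>1 - z\<close>, has coefficients that grow like powers of a logarithm: in the difference of the two products all terms with a shorter word
  from the solutions cancel, and the remaining one is the constant times \<open>E z [] = 1\<close>.
\<close>

lemma solves_KZ_unique_limit:
  assumes "solves_KZ G" "solves_KZ H" and E: "\<And>z. E z [] = 1"
    and F: "F \<noteq> bot" "eventually (\<lambda>z. z \<in> {0<..<1}) F"
    and G: "\<And>w. ((\<lambda>z. nc_mult (G z) (E z) w) \<longlongrightarrow> nc_one w) F"
    and H: "\<And>w. ((\<lambda>z. nc_mult (H z) (E z) w) \<longlongrightarrow> nc_one w) F"
    and z: "z \<in> {0<..<1}"
  shows "G z = H z"
  using assms(1,2) _ z
proof (rule solves_KZ_unique)
  fix w k
  assume IH: "\<And>v z. length v < length w \<Longrightarrow> z \<in> {0<..<1} \<Longrightarrow> G z v = H z v"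
    and k: "\<And>z. z \<in> {0<..<1} \<Longrightarrow> G z w - H z w = k"
  have "nc_mult (G z) (E z) w - nc_mult (H z) (E z) w = k" if z: "z \<in> {0<..<1}" for z
  proof -
    have "nc_mult (G z) (E z) w - nc_mult (H z) (E z) w
        = (\<Sum>i\<le>length w. (G z (take i w) - H z (take i w)) * E z (drop i w))"
      by (simp add: nc_mult_def sum_subtractf left_diff_distrib)
    also have "\<dots> = (\<Sum>i\<in>{length w}. (G z (take i w) - H z (take i w)) * E z (drop i w))"
      using IH z by (intro sum.mono_neutral_right) auto
    finally show ?thesis using k[OF z] by (simp add: E)
  qed
  then have "eventually (\<lambda>z. nc_mult (G z) (E z) w - nc_mult (H z) (E z) w = k) F"
    using F(2) by (auto elim: eventually_mono)
  moreover have "((\<lambda>z. nc_mult (G z) (E z) w - nc_mult (H z) (E z) w) \<longlongrightarrow> nc_one w - nc_one w) F"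
    by (intro tendsto_diff G H)
  ultimately have "((\<lambda>z. k) \<longlongrightarrow> 0) F" by (simp add: tendsto_cong)
  then show "k = 0" using F(1) by (simp add: tendsto_const_iff)
qed

lemma sol0_unique:
  assumes "solves_KZ G" "asymp_at_0 G" "z \<in> {0<..<1}"
  shows "G z = kz_sol0 z"
  using assms asymp_at_0_sol0 unfolding asymp_at_0_def
  by (intro solves_KZ_unique_limit[where F = "at_right 0"
        and E = "\<lambda>z. nc_exp True (- of_real (ln z) / (2 * of_real pi * \<i>))"] solves_KZ_sol0)
     (auto intro: eventually_at_rightI[of 0 1])

lemma sol1_unique:
  assumes "solves_KZ G" "asymp_at_1 G" "z \<in> {0<..<1}"
  shows "G z = kz_sol1 z"
  using assms asymp_at_1_sol1 unfolding asymp_at_1_def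
  by (intro solves_KZ_unique_limit[where F = "at_left 1"
        and E = "\<lambda>z. nc_exp False (- of_real (ln (1 - z)) / (2 * of_real pi * \<i>))"] solves_KZ_sol1)
     (auto intro: eventually_at_leftI[of 0 1])

section \<open>Growth of the KZ associator\<close>

lemma kz_sol0_Nil: "kz_sol0 z [] = 1"
proof -
  have "kz_regular z [] = (\<Sum>n\<in>{0}. kz_coeff n [] * of_real z ^ n)"
    unfolding kz_regular_def by (rule suminf_finite) auto
  then show ?thesis by (simp add: kz_sol0_def nc_mult_Nil)
qed

lemma kz_sol1_Nil: "kz_sol1 z [] = 1"
  by (simp add: kz_sol1_def kz_sol0_Nil)

lemma solves_KZ_mult_right:
  assumes "solves_KZ G"
  shows "solves_KZ (\<lambda>z. nc_mult (G z) f)"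
  unfolding solves_KZ_def
proof (intro ballI allI)
  fix z :: real and w assume z: "z \<in> {0<..<1}"
  let ?c = "1 / (2 * of_real pi * \<i>)"
  have "((\<lambda>t. nc_mult (G t) f w) has_vector_derivative
      nc_mult (\<lambda>v. ?c * (nc_mult (nc_letter True) (G z) v / of_real z
        + nc_mult (nc_letter False) (G z) v / of_real (z - 1))) f w + nc_mult (G z) (\<lambda>v. 0) w) (at z)"
    using assms z unfolding solves_KZ_def by (intro nc_mult_has_vector_derivative) auto
  also have "(\<lambda>v. ?c * (nc_mult (nc_letter True) (G z) v / of_real z
        + nc_mult (nc_letter False) (G z) v / of_real (z - 1)))
      = (\<lambda>v. ?c / of_real z * nc_mult (nc_letter True) (G z) v
        + ?c / of_real (z - 1) * nc_mult (nc_letter False) (G z) v)"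
    by (simp add: distrib_left)
  also have "nc_mult \<dots> f w + nc_mult (G z) (\<lambda>v. 0) w
      = ?c * (nc_mult (nc_letter True) (nc_mult (G z) f) w / of_real z
        + nc_mult (nc_letter False) (nc_mult (G z) f) w / of_real (z - 1))"
    unfolding nc_mult_add_left nc_mult_scale_left nc_mult_assoc by (simp add: nc_mult_def distrib_left)
  finally show "((\<lambda>t. nc_mult (G t) f w) has_vector_derivative
      ?c * (nc_mult (nc_letter True) (nc_mult (G z) f) w / of_real z
        + nc_mult (nc_letter False) (nc_mult (G z) f) w / of_real (z - 1))) (at z)" .
qed

text \<open>
  Right multiplication by a constant series preserves the KZ equation. So \<open>G\<^sub>1 \<Phi>\<close> and \<open>G\<^sub>0\<close>, which agree at
  \<open>1/2\<close> by the choice of \<open>\<Phi>\<close>, agree everywhere, and \<open>G\<^sub>1\<^sup>-\<^sup>1 G\<^sub>0\<close> is constant. Together with the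
  uniqueness of the normalized solutions this resolves the definite description.
\<close>

lemma KZ_associator_eq:
  "KZ_associator = nc_mult (nc_inverse (kz_sol1 (1/2))) (kz_sol0 (1/2))" (is "_ = ?\<Phi>")
proof -
  have half: "1/2 \<in> {0<..<1::real}" by simp
  have "kz_sol0 z = nc_mult (kz_sol1 z) ?\<Phi>" if z: "z \<in> {0<..<1}" for z
  proof (rule solves_KZ_unique_at[OF solves_KZ_sol0 _ _ half z])
    show "solves_KZ (\<lambda>z. nc_mult (kz_sol1 z) ?\<Phi>)"
      by (rule solves_KZ_mult_right[OF solves_KZ_sol1])
    show "kz_sol0 (1/2) = nc_mult (kz_sol1 (1/2)) ?\<Phi>"
      using nc_inverse_right[of "kz_sol1 (1/2)", OF kz_sol1_Nil] by (simp flip: nc_mult_assoc)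
  qed
  then have "?\<Phi> = nc_mult (nc_inverse (kz_sol1 z)) (kz_sol0 z)" if "z \<in> {0<..<1}" for z
    using that nc_inverse_left[of "kz_sol1 z", OF kz_sol1_Nil]
    by (metis nc_mult_assoc nc_mult_one_left)
  then have ex: "\<exists>G0 G1. solves_KZ G0 \<and> asymp_at_0 G0 \<and> solves_KZ G1 \<and> asymp_at_1 G1
      \<and> (\<forall>z\<in>{0<..<1}. ?\<Phi> = nc_mult (nc_inverse (G1 z)) (G0 z))"
    using solves_KZ_sol0 asymp_at_0_sol0 solves_KZ_sol1 asymp_at_1_sol1 by blast
  show ?thesis
    unfolding KZ_associator_def
  proof (rule the_equality, rule ex)
    fix \<Psi> assume "\<exists>G0 G1. solves_KZ G0 \<and> asymp_at_0 G0 \<and> solves_KZ G1 \<and> asymp_at_1 G1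
      \<and> (\<forall>z\<in>{0<..<1}. \<Psi> = nc_mult (nc_inverse (G1 z)) (G0 z))"
    then obtain G0 G1 where "solves_KZ G0" "asymp_at_0 G0" "solves_KZ G1" "asymp_at_1 G1"
      and \<Psi>: "\<Psi> = nc_mult (nc_inverse (G1 (1/2))) (G0 (1/2))" using half by blast
    then have "G0 (1/2) = kz_sol0 (1/2)" "G1 (1/2) = kz_sol1 (1/2)"
      using half by (blast intro: sol0_unique sol1_unique)+
    then show "\<Psi> = ?\<Phi>" by (simp only: \<Psi>)
  qed
qed

text \<open>
  At \<open>1/2\<close>, where the two solutions are compared, the regular factor is bounded by the geometric series
  with sum 2.
\<close>

lemma nc_geom_bounded_kz_sol0: "nc_geom_bounded (kz_sol0 (1/2))"
  unfolding kz_sol0_def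
proof (rule nc_geom_bounded_mult[OF _ nc_geom_bounded_exp])
  have "norm (kz_regular (1/2) w) \<le> 2" for w
  proof -
    have "norm (kz_regular (1/2) w) \<le> suminf (\<lambda>n. (1/2::real) ^ n)"
      unfolding kz_regular_def
    proof (rule norm_suminf_le)
      show "norm (kz_coeff n w * of_real (1/2) ^ n) \<le> (1/2) ^ n" for n
        using mult_right_mono[OF norm_kz_coeff_le, of "(1/2) ^ n" n w]
        by (simp add: norm_mult norm_power norm_divide)
    qed (auto intro: summable_geometric)
    then show ?thesis by (simp add: suminf_geometric)
  qed
  moreover have "geom_bounded (\<lambda>n. 2)" by (rule geom_boundedI[where M = 2 and C = 1]) simp
  ultimately show "nc_geom_bounded (kz_regular (1/2))"
    unfolding nc_geom_bounded_def by (intro exI[of _ "\<lambda>n. 2"]) auto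
qed

lemma nc_geom_bounded_kz_sol1: "nc_geom_bounded (kz_sol1 (1/2))"
proof -
  obtain u where "geom_bounded u" and u: "\<And>w. norm (kz_sol0 (1/2) w) \<le> u (length w)"
    using nc_geom_bounded_kz_sol0 unfolding nc_geom_bounded_def by blast
  moreover have "norm (kz_sol1 (1/2) w) \<le> u (length w)" for w
    using u[of "map Not w"] by (simp add: kz_sol1_def)
  ultimately show ?thesis unfolding nc_geom_bounded_def by blast
qed

lemma KZ_associator_Nil: "KZ_associator [] = 1"
proof -
  have "nc_mult (nc_inverse (kz_sol1 (1/2))) (kz_sol1 (1/2)) [] = nc_one []"
    using nc_inverse_left[of "kz_sol1 (1/2)", OF kz_sol1_Nil] by simp
  then show ?thesis
    by (simp add: KZ_associator_eq nc_mult_Nil kz_sol0_Nil kz_sol1_Nil nc_one_def)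
qed

lemma nc_geom_bounded_associator: "nc_geom_bounded KZ_associator"
  unfolding KZ_associator_eq
  by (intro nc_geom_bounded_mult nc_geom_bounded_inverse nc_geom_bounded_kz_sol0
      nc_geom_bounded_kz_sol1 kz_sol1_Nil)

section \<open>The Kontsevich integral of a tangle\<close>

lemma card_listset_le:
  assumes "\<And>A. A \<in> set As \<Longrightarrow> finite A \<and> card A \<le> K"
  shows "card (listset As) \<le> K ^ length As"
  using assms
proof (induction As)
  case (Cons A As)
  have "listset (A # As) = (\<lambda>(x, xs). x # xs) ` (A \<times> listset As)"
    by (auto simp: set_Cons_def)
  moreover have "inj_on (\<lambda>(x, xs). x # xs) (A \<times> listset As)" by (auto simp: inj_on_def)
  ultimately have "card (listset (A # As)) = card A * card (listset As)"
    by (simp only: card_image card_cartesian_product)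
  also have "\<dots> \<le> K * K ^ length As" using Cons by (intro mult_le_mono) auto
  finally show ?case by simp
qed simp

lemma geom_bounded_scale:
  assumes "geom_bounded u" "D \<ge> 0"
  shows "geom_bounded (\<lambda>n. D ^ n * u n)"
proof -
  obtain C where C: "C \<ge> 1" "\<And>n. u n \<le> C ^ Suc n"
    using assms(1) unfolding geom_bounded_def by blast
  have "D ^ n * u n \<le> C * (D * C) ^ n" for n
    using mult_left_mono[OF C(2)[of n], of "D ^ n"] assms(2) by (simp add: power_mult_distrib mult_ac)
  then show ?thesis by (rule geom_boundedI)
qed

text \<open>
  There are \<open>2 ^ n\<close> words of length \<open>n\<close>, and each letter is replaced by one of at most \<open>K\<close> chords.
\<close>

lemma geom_bounded_cabled:
  assumes "nc_geom_bounded \<Phi>"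
  shows "geom_bounded_series (cabled \<Phi> us vs ws)"
proof -
  obtain u where u: "geom_bounded u" "\<And>w. norm (\<Phi> w) \<le> u (length w)"
    using assms unfolding nc_geom_bounded_def by blast
  define os p q r where "os = us @ vs @ ws" and "p = length us"
    and "q = length us + length vs" and "r = length os"
  define chords where "chords = (\<lambda>l. if l then {0..<p} \<times> {p..<q} else {p..<q} \<times> {q..<r})"
  define sg :: "nat \<Rightarrow> complex" where "sg = (\<lambda>i. if os ! i then 1 else - 1)"
  let ?t = "\<lambda>\<omega> cs. Poly_Mapping.single (chord_diag os id cs)
             (\<Phi> \<omega> * prod_list (map (\<lambda>(i, j). sg i * sg j) cs))"
  have eq: "cabled \<Phi> us vs ws n = (\<Sum>\<omega> | length \<omega> = n. \<Sum>cs\<in>listset (map chords \<omega>). ?t \<omega> cs)" for n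
    unfolding cabled_def Let_def os_def p_def q_def r_def chords_def sg_def by (rule refl)
  have sg: "norm (prod_list (map (\<lambda>(i, j). sg i * sg j) cs)) = 1" for cs
    by (induction cs) (auto simp: norm_mult sg_def)
  define K where "K = max (card (chords True)) (card (chords False))"
  have chords: "finite (chords l) \<and> card (chords l) \<le> K" for l
    by (cases l) (auto simp: K_def chords_def)
  have "l1 (cabled \<Phi> us vs ws n) \<le> real (2 * K) ^ n * u n" for n
  proof -
    have u0: "0 \<le> u n" using order_trans[OF norm_ge_zero u(2)[of "replicate n True"]] by simp
    have "l1 (cabled \<Phi> us vs ws n) \<le> (\<Sum>\<omega> | length \<omega> = n. \<Sum>cs\<in>listset (map chords \<omega>). l1 (?t \<omega> cs))"
      unfolding eq by (intro order_trans[OF l1_sum] sum_mono l1_sum)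
    also have "\<dots> \<le> (\<Sum>\<omega>\<in>{\<omega> :: bool list. length \<omega> = n}. real K ^ n * u n)"
    proof (intro sum_mono)
      fix \<omega> :: "bool list" assume \<omega>: "\<omega> \<in> {\<omega>. length \<omega> = n}"
      have "(\<Sum>cs\<in>listset (map chords \<omega>). l1 (?t \<omega> cs)) = card (listset (map chords \<omega>)) * norm (\<Phi> \<omega>)"
        by (simp add: norm_mult sg)
      also have "\<dots> \<le> real (K ^ n) * u n"
      proof (intro mult_mono)
        show "real (card (listset (map chords \<omega>))) \<le> real (K ^ n)"
          using card_listset_le[of "map chords \<omega>" K] chords \<omega> by (simp flip: of_nat_power) auto
        show "norm (\<Phi> \<omega>) \<le> u n" using u(2)[of \<omega>] \<omega> by simp
      qed auto
      finally show "(\<Sum>cs\<in>listset (map chords \<omega>). l1 (?t \<omega> cs)) \<le> real K ^ n * u n" by simp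
    qed
    also have "\<dots> = card {\<omega> :: bool list. length \<omega> = n} * (real K ^ n * u n)" by simp
    also have "card {\<omega> :: bool list. length \<omega> = n} = 2 ^ n"
      using card_lists_length_eq[of "UNIV :: bool set" n] by simp
    also have "real (2 ^ n) * (real K ^ n * u n) = real (2 * K) ^ n * u n"
      by (simp only: of_nat_mult of_nat_power of_nat_numeral power_mult_distrib mult.assoc)
    finally show ?thesis .
  qed
  moreover have "geom_bounded (\<lambda>n. real (2 * K) ^ n * u n)"
    using u(1) by (rule geom_bounded_scale) (rule of_nat_0_le_iff)
  ultimately show ?thesis by (rule geom_bounded_mono[rotated])
qed

theorem geom_bounded_kontsevich:
  assumes s: "geom_bounded_series s"
  shows "geom_bounded_series (kontsevich s T)"
proof (induction T)
  case (Straight u)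
  show ?case by (rule geom_boundedI[where M = 1 and C = 1]) simp
next
  case (Crossing r a b)
  have "l1 (kontsevich s (Crossing r a b) n) \<le> 1 * 1 ^ n" for n
  proof -
    have "l1 (kontsevich s (Crossing r a b) n) = (1 / 2) ^ n / fact n"
      by (simp add: norm_divide norm_power norm_fact)
    also have "\<dots> \<le> 1 / 1" by (intro frac_le power_le_one fact_ge_1) auto
    finally show ?thesis by simp
  qed
  then show ?case by (rule geom_boundedI)
next
  case (Minimum a)
  show ?case
    using s by (rule geom_bounded_mono)
      (use l1_linext[of "\<lambda>D. Poly_Mapping.single (extremum_diag (min_strand a) D) 1" 1] in auto)
next
  case (Maximum a)
  show ?case
    using s by (rule geom_bounded_mono)
      (use l1_linext[of "\<lambda>D. Poly_Mapping.single (extremum_diag (max_strand a) D) 1" 1] in auto)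
next
  case (Assoc u v w)
  show ?case using geom_bounded_cabled[OF nc_geom_bounded_associator] by simp
next
  case (AssocInv u v w)
  have "nc_geom_bounded (nc_inverse KZ_associator)"
    by (intro nc_geom_bounded_inverse nc_geom_bounded_associator KZ_associator_Nil)
  from geom_bounded_cabled[OF this] show ?case by simp
next
  case (Juxt S T)
  then show ?case using geom_bounded_graded_prod by simp
next
  case (Comp S T)
  then show ?case using geom_bounded_graded_prod by simp
qed

section \<open>Minimizing the l1-norm over an affine space\<close>

text \<open>
  The fundamental theorem of linear programming for the \<open>l1\<close>-norm, over any ordered field. A point \<open>c\<close> is
  called basic if no direction of the affine space is supported in the support of \<open>c\<close>. From a point
  that is not basic one can move along such a direction, with the sign for which the norm does not
  increase, until the first coordinate vanishes; this reduces the support. Basic points are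
  determined by their supports, so there are finitely many, and the minimum over them is the minimum.
\<close>

lemma l1_minimum_attained:
  fixes S :: "('a \<Rightarrow> 'b::linordered_field) set"
  assumes F: "finite F" and supp: "\<And>c x. c \<in> S \<Longrightarrow> c x \<noteq> 0 \<Longrightarrow> x \<in> F"
    and affine: "\<And>a b c t. a \<in> S \<Longrightarrow> b \<in> S \<Longrightarrow> c \<in> S \<Longrightarrow> (\<lambda>x. c x + t * (a x - b x)) \<in> S"
    and "S \<noteq> {}"
  shows "\<exists>c\<in>S. \<forall>c'\<in>S. (\<Sum>x\<in>F. \<bar>c x\<bar>) \<le> (\<Sum>x\<in>F. \<bar>c' x\<bar>)"
proof -
  define N where "N c = (\<Sum>x\<in>F. \<bar>c x\<bar>)" for c :: "'a \<Rightarrow> 'b"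
  define basic where "basic c \<longleftrightarrow> (\<forall>a\<in>S. \<forall>b\<in>S. (\<forall>x. a x \<noteq> b x \<longrightarrow> c x \<noteq> 0) \<longrightarrow> a = b)"
    for c :: "'a \<Rightarrow> 'b"
  have reduce: "\<exists>b\<in>S. basic b \<and> N b \<le> N c" if "c \<in> S" for c
    using that
  proof (induction "card {x\<in>F. c x \<noteq> 0}" arbitrary: c rule: less_induct)
    case less
    show ?case
    proof (cases "basic c")
      case False
      then obtain a0 b0 where ab0: "a0 \<in> S" "b0 \<in> S" "a0 \<noteq> b0" "\<And>x. a0 x \<noteq> b0 x \<Longrightarrow> c x \<noteq> 0"
        unfolding basic_def by blast
      \<comment> \<open>The derivative of the norm at \<open>c\<close> in the direction \<open>b - a\<close> is \<open>- \<sigma> a b\<close>.\<close>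
      define \<sigma> where "\<sigma> a b = (\<Sum>x\<in>F. sgn (c x) * (a x - b x))" for a b :: "'a \<Rightarrow> 'b"
      have "\<sigma> b0 a0 = - \<sigma> a0 b0"
        unfolding \<sigma>_def sum_negf[symmetric] by (intro sum.cong) (simp_all add: algebra_simps)
      then have "\<sigma> a0 b0 \<ge> 0 \<or> \<sigma> b0 a0 \<ge> 0" by auto
      then obtain a b where ab: "a \<in> S" "b \<in> S" "a \<noteq> b" "\<And>x. a x \<noteq> b x \<Longrightarrow> c x \<noteq> 0"
        and \<sigma>: "\<sigma> a b \<ge> 0" using ab0 by metis
      define v where "v x = a x - b x" for x
      have v: "c x = 0 \<Longrightarrow> v x = 0" "v x \<noteq> 0 \<Longrightarrow> x \<in> F" for x
        using ab(4)[of x] supp[OF less.prems, of x] by (auto simp: v_def)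
      define P where "P = {x\<in>F. c x * v x > 0}"
      \<comment> \<open>\<open>P\<close> consists of the coordinates that move towards 0. If there were none, the norm would
      strictly increase.\<close>
      have "P \<noteq> {}"
      proof
        assume P: "P = {}"
        obtain y where y: "v y \<noteq> 0" using ab(3) by (auto simp: v_def)
        have le: "sgn (c x) * v x \<le> 0" if "x \<in> F" for x
        proof -
          have "c x * v x \<le> 0" using P that by (auto simp: P_def not_less)
          then show ?thesis by (auto simp: sgn_if mult_le_0_iff)
        qed
        have "sgn (c y) * v y < 0"
          using le[OF v(2)[OF y]] y v(1)[of y] by (auto simp: less_le sgn_0_0)
        then have "(\<Sum>x\<in>F. sgn (c x) * v x) < (\<Sum>x\<in>F. 0)"
          using v(2)[OF y] le by (intro sum_strict_mono_ex1 F) auto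
        then show False using \<sigma> by (simp add: \<sigma>_def v_def)
      qed
      have "finite P" using F by (simp add: P_def)
      define t where "t = Min ((\<lambda>x. c x / v x) ` P)"
      have "t \<in> (\<lambda>x. c x / v x) ` P" unfolding t_def
        using \<open>finite P\<close> \<open>P \<noteq> {}\<close> by (intro Min_in) auto
      then obtain x0 where x0: "x0 \<in> P" "t = c x0 / v x0" by blast
      have t_le: "t \<le> c x / v x" if "x \<in> P" for x
        unfolding t_def using \<open>finite P\<close> that by (intro Min_le) auto
      have t: "t > 0" using x0 by (auto simp: P_def zero_less_mult_iff zero_less_divide_iff)
      define c' where "c' x = c x - t * v x" for x
      have "(\<lambda>x. c x + t * (b x - a x)) \<in> S" using ab less.prems by (intro affine)
      also have "(\<lambda>x. c x + t * (b x - a x)) = c'" by (auto simp: c'_def v_def algebra_simps)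
      finally have c'S: "c' \<in> S" .
      have "{x\<in>F. c' x \<noteq> 0} \<subset> {x\<in>F. c x \<noteq> 0}"
      proof
        show "{x\<in>F. c' x \<noteq> 0} \<subseteq> {x\<in>F. c x \<noteq> 0}" using v(1) by (auto simp: c'_def)
        have "c' x0 = 0" "c x0 \<noteq> 0" "x0 \<in> F" using x0 by (auto simp: c'_def P_def)
        then show "{x\<in>F. c' x \<noteq> 0} \<noteq> {x\<in>F. c x \<noteq> 0}" by blast
      qed
      then have "card {x\<in>F. c' x \<noteq> 0} < card {x\<in>F. c x \<noteq> 0}"
        using F by (intro psubset_card_mono) auto
      from less.hyps[OF this c'S] obtain b' where b': "b' \<in> S" "basic b'" "N b' \<le> N c'" by blast
      have "\<bar>c' x\<bar> = \<bar>c x\<bar> - t * (sgn (c x) * v x)" if x: "x \<in> F" for x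
      proof -
        consider "c x = 0" | "c x > 0" | "c x < 0" by fastforce
        then show ?thesis
        proof cases
          case 2
          have "t * v x \<le> c x"
          proof (cases "v x > 0")
            case True
            then show ?thesis using t_le[of x] 2 x by (simp add: P_def field_simps)
          next
            case False
            then have "t * v x \<le> 0" using t by (simp add: mult_le_0_iff)
            then show ?thesis using 2 by simp
          qed
          then show ?thesis using 2 by (simp add: c'_def)
        next
          case 3
          have "c x \<le> t * v x"
          proof (cases "v x < 0")
            case True
            then have "x \<in> P" using 3 x by (simp add: P_def mult_neg_neg)
            then show ?thesis using t_le[of x] True by (simp add: field_simps)
          next
            case False
            then have "0 \<le> t * v x" using t by simp
            then show ?thesis using 3 by simp
          qed
          then show ?thesis using 3 by (simp add: c'_def)
        qed (simp add: c'_def v)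
      qed
      then have "N c' = N c - t * \<sigma> a b"
        by (simp add: N_def \<sigma>_def v_def sum_subtractf sum_distrib_left)
      also have "\<dots> \<le> N c" using t \<sigma> by simp
      finally show ?thesis using b' by (meson order_trans)
    qed (use less.prems in blast)
  qed
  have "inj_on (\<lambda>b. {x\<in>F. b x \<noteq> 0}) {b\<in>S. basic b}"
  proof (rule inj_onI)
    fix b b' assume b: "b \<in> {b\<in>S. basic b}" "b' \<in> {b\<in>S. basic b}"
      and eq: "{x\<in>F. b x \<noteq> 0} = {x\<in>F. b' x \<noteq> 0}"
    have "b x \<noteq> 0" if "b x \<noteq> b' x" for x
    proof
      assume "b x = 0"
      then have "b' x \<noteq> 0" using that by simp
      then show False using eq supp[of b' x] b \<open>b x = 0\<close> by blast
    qed
    then show "b = b'" using b unfolding basic_def by blast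
  qed
  moreover have "finite ((\<lambda>b. {x\<in>F. b x \<noteq> 0}) ` {b\<in>S. basic b})"
    by (rule finite_subset[of _ "Pow F"]) (use F in auto)
  ultimately have fin: "finite {b\<in>S. basic b}" by (rule finite_imageD[rotated])
  have ne: "{b\<in>S. basic b} \<noteq> {}" using reduce \<open>S \<noteq> {}\<close> by blast
  have "Min (N ` {b\<in>S. basic b}) \<in> N ` {b\<in>S. basic b}" using fin ne by (intro Min_in) auto
  then obtain c where c: "c \<in> S" "Min (N ` {b\<in>S. basic b}) = N c" by auto
  have "N c \<le> N c'" if c': "c' \<in> S" for c'
  proof -
    obtain b where b: "b \<in> S" "basic b" "N b \<le> N c'" using reduce[OF c'] by blast
    have "N c \<le> N b" unfolding c(2)[symmetric] using fin b by (intro Min_le) auto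
    with b(3) show ?thesis by simp
  qed
  with c(1) show ?thesis unfolding N_def by blast
qed

section \<open>The relations among Jacobi diagrams\<close>

text \<open>
  For AS and IHX, where the ends of edges are merely permuted.
\<close>

lemma jdiags_cong:
  assumes "D \<in> jdiags X Y" "mset (edge_ends D) = mset (edge_ends E)"
    "map fst (comps E) = map fst (comps D)" "labs E = labs D"
  shows "E \<in> jdiags X Y"
  using assms unfolding jdiags_def
  by (auto simp flip: count_mset set_mset_mset)

lemma edge_ends_JD:
  "edge_ends (JD vs cs ls) = concat (map (\<lambda>(a, b, c). [a, b, c]) vs) @ concat (map snd cs) @ map snd ls"
  by (simp add: edge_ends_def)

text \<open>
  For STU: the two diagrams with one trivalent vertex less lack precisely the edge \<open>e\<close> that joins this
  vertex to the strand.
\<close>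

lemma jdiags_delete_edge:
  assumes "D \<in> jdiags X Y" "mset (edge_ends D) = add_mset e (add_mset e (mset (edge_ends E)))"
    "map fst (comps E) = map fst (comps D)" "labs E = labs D"
  shows "E \<in> jdiags X Y"
proof -
  have D: "count (mset (edge_ends D)) x = 2" if "x \<in># mset (edge_ends D)" for x
    using assms(1) that by (simp add: jdiags_def count_mset)
  have "count (mset (edge_ends E)) x = 2" if x: "x \<in># mset (edge_ends E)" for x
  proof -
    have "x \<in># mset (edge_ends D)" unfolding assms(2) using x by simp
    from D[OF this] have "count (mset (edge_ends E)) x + (if x = e then 2 else 0) = 2"
      unfolding assms(2) by (auto split: if_splits)
    then show ?thesis using x by (auto split: if_splits simp: count_eq_zero_iff)
  qed
  then show ?thesis using assms(1,3,4) by (auto simp: jdiags_def count_mset)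
qed

text \<open>
  In STU a trivalent vertex is traded for a leg, so the number of all vertices changes neither there
  nor in the other relations. Consequently projection to one degree preserves the span of the
  relations.
\<close>

lemma jrel_homogeneous:
  assumes "r \<in> jrel X Y"
  obtains n where "Poly_Mapping.keys r \<subseteq> {D\<in>jdiags X Y. jdegree D = n}"
proof -
  have sub1: "Poly_Mapping.keys (p - q) \<subseteq> A" if "Poly_Mapping.keys p \<subseteq> A" "Poly_Mapping.keys q \<subseteq> A"
    for p q :: chain and A using that Poly_Mapping.keys_diff[of p q] by blast
  have sub2: "Poly_Mapping.keys (p + q) \<subseteq> A" if "Poly_Mapping.keys p \<subseteq> A" "Poly_Mapping.keys q \<subseteq> A"
    for p q :: chain and A using that Poly_Mapping.keys_add[of p q] by blast
  have sub3: "Poly_Mapping.keys (Poly_Mapping.single D (1::complex)) \<subseteq> A" if "D \<in> A" for D A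
    using that by simp
  note sub = sub1 sub2 sub3
  have "\<exists>n. Poly_Mapping.keys r \<subseteq> {D\<in>jdiags X Y. jdegree D = n}"
    using assms
  proof cases
    case (ISO D E)
    then obtain f where f: "mset (map cyc (verts (map_jgraph f D))) = mset (map cyc (verts E))"
      "list_all2 same_legs (comps (map_jgraph f D)) (comps E)"
      "mset (labs (map_jgraph f D)) = mset (labs E)" unfolding jiso_def by blast
    have "length (verts D) = length (verts E)"
      using arg_cong[OF f(1), of size] by (simp add: jgraph.map_sel)
    moreover have "length (labs D) = length (labs E)"
      using arg_cong[OF f(3), of size] by (simp add: jgraph.map_sel)
    moreover have "length (concat (map snd cs)) = length (concat (map snd cs'))"
      if "list_all2 same_legs cs cs'" for cs cs'
      using that by induction (auto simp: same_legs_def)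
    from this[OF f(2)] have "length (concat (map snd (comps D))) = length (concat (map snd (comps E)))"
      by (simp add: jgraph.map_sel o_def length_concat)
    ultimately have "jdegree E = jdegree D" by (simp add: jdegree_def legs_no_def)
    then show ?thesis unfolding ISO(1)
      by (intro exI[of _ "jdegree D"] sub) (use ISO in auto)
  next
    case (AS a b c vs cs ls)
    have "JD ((b, a, c) # vs) cs ls \<in> jdiags X Y"
      by (rule jdiags_cong[OF AS(2)]) (simp_all add: edge_ends_JD add_mset_commute)
    then show ?thesis unfolding AS(1)
      by (intro exI[of _ "jdegree (JD ((a, b, c) # vs) cs ls)"] sub)
         (use AS in \<open>auto simp: jdegree_def legs_no_def\<close>)
  next
    case (IHX b a e c d vs cs ls)
    have "JD ((e, a, c) # (b, e, d) # vs) cs ls \<in> jdiags X Y"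
      "JD ((c, b, e) # (e, a, d) # vs) cs ls \<in> jdiags X Y"
      by (rule jdiags_cong[OF IHX(2)]; simp add: edge_ends_JD add_mset_commute)+
    then show ?thesis unfolding IHX(1)
      by (intro exI[of _ "jdegree (JD ((b, a, e) # (e, c, d) # vs) cs ls)"] sub)
         (use IHX in \<open>auto simp: jdegree_def legs_no_def\<close>)
  next
    case (STU c b a vs cs k us ws cs' ls)
    have "JD vs (cs @ (k, us @ [a, b] @ ws) # cs') ls \<in> jdiags X Y"
      "JD vs (cs @ (k, us @ [b, a] @ ws) # cs') ls \<in> jdiags X Y"
      by (rule jdiags_delete_edge[OF STU(2), of c]; simp add: edge_ends_JD add_mset_commute)+
    then show ?thesis unfolding STU(1)
      by (intro exI[of _ "jdegree (JD ((c, b, a) # vs) (cs @ (k, us @ [c] @ ws) # cs') ls)"] sub)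
         (use STU in \<open>auto simp: jdegree_def legs_no_def\<close>)
  qed
  then show ?thesis using that by blast
qed

lemma lookup_jrel: "r \<in> jrel X Y \<Longrightarrow> Poly_Mapping.lookup r D \<in> \<int>"
  by (induction rule: jrel.induct)
     (auto simp: lookup_minus lookup_add lookup_single when_def intro!: Ints_diff Ints_add)

section \<open>Chains and relations over a ring of coefficients\<close>

text \<open>
  The common properties of \<open>\<rat>\<close> and \<open>UNIV\<close> that make the chains, and the span of the relations, closed
  under linear combinations. The integers have to be included since they occur as the
  coefficients of the relations.
\<close>

definition coeff_ring :: "complex set \<Rightarrow> bool" where
  "coeff_ring K \<longleftrightarrow> \<int> \<subseteq> K \<and> (\<forall>a\<in>K. \<forall>b\<in>K. a + b \<in> K \<and> a * b \<in> K)"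

lemma coeff_ring_Rats: "coeff_ring \<rat>" and coeff_ring_UNIV: "coeff_ring UNIV"
  by (auto simp: coeff_ring_def elim: Ints_cases)

lemma coeff_ringD:
  assumes "coeff_ring K"
  shows "0 \<in> K" "1 \<in> K" "-1 \<in> K" "a \<in> \<int> \<Longrightarrow> a \<in> K"
    "a \<in> K \<Longrightarrow> b \<in> K \<Longrightarrow> a + b \<in> K" "a \<in> K \<Longrightarrow> b \<in> K \<Longrightarrow> a * b \<in> K"
  using assms by (auto simp: coeff_ring_def)

lemma jchainsI:
  assumes "\<And>D. Poly_Mapping.lookup p D \<in> K" "\<And>D. Poly_Mapping.lookup p D \<noteq> 0 \<Longrightarrow> D \<in> jdiags X Y"
  shows "p \<in> jchains K X Y"
  using assms by (auto simp: jchains_def in_keys_iff)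

lemma jchainsD:
  assumes "p \<in> jchains K X Y"
  shows "Poly_Mapping.lookup p D \<in> K" "Poly_Mapping.lookup p D \<noteq> 0 \<Longrightarrow> D \<in> jdiags X Y"
  using assms by (auto simp: jchains_def in_keys_iff)

lemma jchains_add:
  assumes "coeff_ring K" "p \<in> jchains K X Y" "q \<in> jchains K X Y"
  shows "p + q \<in> jchains K X Y"
proof (rule jchainsI)
  show "Poly_Mapping.lookup (p + q) D \<in> K" for D
    using assms by (auto simp: lookup_add intro: coeff_ringD jchainsD)
  show "D \<in> jdiags X Y" if "Poly_Mapping.lookup (p + q) D \<noteq> 0" for D
    using that jchainsD(2)[OF assms(2), of D] jchainsD(2)[OF assms(3), of D]
    by (cases "Poly_Mapping.lookup p D = 0") (simp_all add: lookup_add)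
qed

lemma jchains_cscale:
  assumes "coeff_ring K" "a \<in> K" "p \<in> jchains K X Y"
  shows "cscale a p \<in> jchains K X Y"
  using assms by (intro jchainsI) (auto intro: coeff_ringD jchainsD)

lemma jchains_0: "coeff_ring K \<Longrightarrow> 0 \<in> jchains K X Y"
  by (intro jchainsI) (auto intro: coeff_ringD)

lemma jchains_diff:
  assumes "coeff_ring K" "p \<in> jchains K X Y" "q \<in> jchains K X Y"
  shows "p - q \<in> jchains K X Y"
proof -
  have eq: "p - q = p + cscale (- 1) q" by (auto intro!: poly_mapping_eqI simp: lookup_add lookup_minus)
  show ?thesis unfolding eq using assms by (intro jchains_add jchains_cscale coeff_ringD)
qed

lemma jchains_sum:
  assumes "coeff_ring K" "\<And>i. i \<in> I \<Longrightarrow> f i \<in> jchains K X Y"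
  shows "(\<Sum>i\<in>I. f i) \<in> jchains K X Y"
  using assms by (induction I rule: infinite_finite_induct) (auto intro: jchains_add jchains_0)

lemma jrel_jchains:
  assumes "coeff_ring K" "r \<in> jrel X Y"
  shows "r \<in> jchains K X Y"
proof (rule jchainsI)
  show "Poly_Mapping.lookup r D \<in> K" for D using assms lookup_jrel coeff_ringD(4) by blast
  show "D \<in> jdiags X Y" if "Poly_Mapping.lookup r D \<noteq> 0" for D
    using assms(2) that by (auto simp: in_keys_iff elim!: jrel_homogeneous)
qed

lemma jspan_iff:
  "p \<in> jspan K X Y \<longleftrightarrow>
    (\<exists>R a. finite R \<and> R \<subseteq> jrel X Y \<and> a ` R \<subseteq> K \<and> p = (\<Sum>r\<in>R. cscale (a r) r))"
  by (auto simp: jspan_def)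

lemma jspan_jchains:
  assumes "coeff_ring K" "p \<in> jspan K X Y"
  shows "p \<in> jchains K X Y"
proof -
  obtain R a where R: "finite R" "R \<subseteq> jrel X Y" "a ` R \<subseteq> K" "p = (\<Sum>r\<in>R. cscale (a r) r)"
    using assms(2) unfolding jspan_iff by blast
  show ?thesis unfolding R(4)
    using R(2,3) by (intro jchains_sum jchains_cscale jrel_jchains assms(1)) auto
qed

lemma jspan_0: "0 \<in> jspan K X Y"
  unfolding jspan_iff by (intro exI[of _ "{}"]) simp

lemma jspan_rel: "a \<in> K \<Longrightarrow> r \<in> jrel X Y \<Longrightarrow> cscale a r \<in> jspan K X Y"
  unfolding jspan_iff by (intro exI[of _ "{r}"] exI[of _ "\<lambda>_. a"]) simp

lemma jspan_cscale:
  assumes "coeff_ring K" "b \<in> K" "p \<in> jspan K X Y"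
  shows "cscale b p \<in> jspan K X Y"
proof -
  obtain R a where R: "finite R" "R \<subseteq> jrel X Y" "a ` R \<subseteq> K" "p = (\<Sum>r\<in>R. cscale (a r) r)"
    using assms(3) unfolding jspan_iff by blast
  then show ?thesis
    unfolding jspan_iff using assms(1,2)
    by (intro exI[of _ R] exI[of _ "\<lambda>r. b * a r"]) (auto simp: cscale_sum intro: coeff_ringD)
qed

lemma jspan_add:
  assumes K: "coeff_ring K" and "p \<in> jspan K X Y" "q \<in> jspan K X Y"
  shows "p + q \<in> jspan K X Y"
proof -
  obtain R a where R: "finite R" "R \<subseteq> jrel X Y" "a ` R \<subseteq> K" "p = (\<Sum>r\<in>R. cscale (a r) r)"
    using assms(2) unfolding jspan_iff by blast
  obtain Q b where Q: "finite Q" "Q \<subseteq> jrel X Y" "b ` Q \<subseteq> K" "q = (\<Sum>r\<in>Q. cscale (b r) r)"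
    using assms(3) unfolding jspan_iff by blast
  let ?a = "\<lambda>r. if r \<in> R then a r else 0" and ?b = "\<lambda>r. if r \<in> Q then b r else 0"
  have "p = (\<Sum>r\<in>R \<union> Q. cscale (?a r) r)"
    unfolding R(4) using R Q by (intro sum.mono_neutral_cong_left) auto
  moreover have "q = (\<Sum>r\<in>R \<union> Q. cscale (?b r) r)"
    unfolding Q(4) using R Q by (intro sum.mono_neutral_cong_left) auto
  ultimately have "p + q = (\<Sum>r\<in>R \<union> Q. cscale (?a r + ?b r) r)"
    by (simp only: cscale_add_left sum.distrib)
  moreover have "(\<lambda>r. ?a r + ?b r) ` (R \<union> Q) \<subseteq> K"
    using R(3) Q(3) by (auto simp: image_subset_iff intro!: coeff_ringD(1,5)[OF K])
  ultimately show ?thesis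
    unfolding jspan_iff using R Q by (intro exI[of _ "R \<union> Q"] exI[of _ "\<lambda>r. ?a r + ?b r"]) blast
qed

lemma jspan_sum:
  assumes "coeff_ring K" "\<And>i. i \<in> I \<Longrightarrow> f i \<in> jspan K X Y"
  shows "(\<Sum>i\<in>I. f i) \<in> jspan K X Y"
  using assms by (induction I rule: infinite_finite_induct) (auto intro: jspan_add jspan_0)

lemma jspan_diff:
  assumes "coeff_ring K" "p \<in> jspan K X Y" "q \<in> jspan K X Y"
  shows "p - q \<in> jspan K X Y"
proof -
  have eq: "p - q = p + cscale (- 1) q" by (auto intro!: poly_mapping_eqI simp: lookup_add lookup_minus)
  show ?thesis unfolding eq using assms by (intro jspan_add jspan_cscale coeff_ringD)
qed

section \<open>The Gromov norm\<close>

definition representatives :: "complex set \<Rightarrow> strand list \<Rightarrow> nat set \<Rightarrow> chain \<Rightarrow> chain set" where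
  "representatives K X Y p = {c \<in> jchains K X Y. p - c \<in> jspan K X Y}"

lemma gromov_norm_eq: "gromov_norm K X Y z n = Inf (l1 ` representatives K X Y (z n))"
  unfolding gromov_norm_def representatives_def l1_def by (rule arg_cong[of _ _ Inf]) auto

lemma bdd_below_l1: "bdd_below (l1 ` A)"
  by (intro bdd_belowI[of _ 0]) auto

lemma representatives_self: "p \<in> jchains K X Y \<Longrightarrow> p \<in> representatives K X Y p"
  by (simp add: representatives_def jspan_0)

lemma gromov_norm_nonneg:
  assumes "z n \<in> jchains K X Y"
  shows "0 \<le> gromov_norm K X Y z n"
  unfolding gromov_norm_eq using representatives_self[OF assms] by (intro cInf_greatest) auto

lemma gromov_norm_le: "c \<in> representatives K X Y (z n) \<Longrightarrow> gromov_norm K X Y z n \<le> l1 c"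
  unfolding gromov_norm_eq by (intro cInf_lower bdd_below_l1) auto

section \<open>Comparison of rational and complex coefficients\<close>

lemma complex_of_rat_eq: "(of_rat q :: complex) = of_real (real_of_rat q)"
  by (cases q) (simp add: of_rat_rat)

text \<open>
  Chain and relations being rational, replacing the coefficients of the relations by their real
  parts replaces the representative by its real part, whose norm is not larger. Approximating
  these coefficients by rational ones then changes the norm as little as desired.
\<close>

lemma representatives_UNIV_approx:
  assumes z: "z \<in> jchains \<rat> X Y" and c: "c \<in> representatives UNIV X Y z" and "\<epsilon> > 0"
  shows "\<exists>c'\<in>representatives \<rat> X Y z. l1 c' \<le> l1 c + \<epsilon>"
proof -
  obtain R a where R: "finite R" "R \<subseteq> jrel X Y" and zc: "z - c = (\<Sum>r\<in>R. cscale (a r) r)"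
    using c unfolding representatives_def jspan_iff by blast
  define \<delta> where "\<delta> = \<epsilon> / (1 + (\<Sum>r\<in>R. l1 r))"
  have pos: "1 + (\<Sum>r\<in>R. l1 r) > 0" by (intro add_pos_nonneg sum_nonneg) auto
  have \<delta>: "\<delta> > 0" using pos \<open>\<epsilon> > 0\<close> by (simp add: \<delta>_def)
  have "\<exists>q. \<bar>Re (a r) - real_of_rat q\<bar> \<le> \<delta>" for r
  proof -
    obtain q where "Re (a r) - \<delta> < real_of_rat q" "real_of_rat q < Re (a r) + \<delta>"
      using of_rat_dense[of "Re (a r) - \<delta>" "Re (a r) + \<delta>"] \<delta> by auto
    then show ?thesis by (intro exI[of _ q]) auto
  qed
  then obtain b where b: "\<And>r. \<bar>Re (a r) - real_of_rat (b r)\<bar> \<le> \<delta>" by metis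
  \<comment> \<open>\<open>c''\<close> is the real part of \<open>c\<close>, and \<open>c'\<close> its rational approximation.\<close>
  define c'' where "c'' = z - (\<Sum>r\<in>R. cscale (of_real (Re (a r))) r)"
  define c' where "c' = z - (\<Sum>r\<in>R. cscale (of_rat (b r)) r)"
  have "(\<Sum>r\<in>R. cscale (of_rat (b r)) r) \<in> jspan \<rat> X Y"
    unfolding jspan_iff using R by (intro exI[of _ R] exI[of _ "\<lambda>r. of_rat (b r)"]) auto
  then have c': "c' \<in> representatives \<rat> X Y z"
    using z unfolding representatives_def c'_def
    by (auto intro: jchains_diff jspan_jchains coeff_ring_Rats)
  have "l1 c'' \<le> l1 c"
  proof (rule l1_mono)
    fix D
    have zD: "Im (Poly_Mapping.lookup z D) = 0"
      using jchainsD(1)[OF z, of D] by (auto elim!: Rats_cases simp: complex_of_rat_eq)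
    have rD: "Im (Poly_Mapping.lookup r D) = 0" if "r \<in> R" for r
    proof -
      have "Poly_Mapping.lookup r D \<in> \<int>" using lookup_jrel that R(2) by blast
      then show ?thesis by (auto elim: Ints_cases)
    qed
    have "c = z - (\<Sum>r\<in>R. cscale (a r) r)" using zc by (simp add: algebra_simps)
    then have "Re (Poly_Mapping.lookup c D) = Re (Poly_Mapping.lookup c'' D)"
      using rD by (simp add: c''_def lookup_minus lookup_sum)
    moreover have "Im (Poly_Mapping.lookup c'' D) = 0"
      using zD rD by (simp add: c''_def lookup_minus lookup_sum)
    ultimately have "norm (Poly_Mapping.lookup c'' D) = \<bar>Re (Poly_Mapping.lookup c D)\<bar>"
      by (simp add: norm_complex_def)
    then show "norm (Poly_Mapping.lookup c'' D) \<le> norm (Poly_Mapping.lookup c D)"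
      using abs_Re_le_cmod by simp
  qed
  moreover have "l1 c' \<le> l1 c'' + \<epsilon>"
  proof -
    have "c' = c'' + (\<Sum>r\<in>R. cscale (of_real (Re (a r) - real_of_rat (b r))) r)"
      by (auto intro!: poly_mapping_eqI simp: c'_def c''_def lookup_add lookup_minus lookup_sum
          left_diff_distrib sum_subtractf complex_of_rat_eq)
    then have "l1 c' \<le> l1 c'' + l1 (\<Sum>r\<in>R. cscale (of_real (Re (a r) - real_of_rat (b r))) r)"
      using l1_add by simp
    also have "\<dots> \<le> l1 c'' + (\<Sum>r\<in>R. \<delta> * l1 r)"
    proof (intro add_left_mono order_trans[OF l1_sum] sum_mono)
      fix r
      show "l1 (cscale (of_real (Re (a r) - real_of_rat (b r))) r) \<le> \<delta> * l1 r"
        unfolding l1_cscale norm_of_real by (intro mult_right_mono b) auto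
    qed
    also have "(\<Sum>r\<in>R. \<delta> * l1 r) = \<epsilon> * ((\<Sum>r\<in>R. l1 r) / (1 + (\<Sum>r\<in>R. l1 r)))"
      unfolding sum_distrib_left[symmetric] by (simp add: \<delta>_def)
    also have "\<dots> \<le> \<epsilon> * 1" using pos \<open>\<epsilon> > 0\<close> by (intro mult_left_mono) (simp_all add: divide_le_eq)
    finally show ?thesis by simp
  qed
  ultimately show ?thesis using c' by (intro bexI[of _ c']) auto
qed

lemma gromov_norm_Rats_le:
  assumes z: "z n \<in> jchains \<rat> X Y"
  shows "gromov_norm \<rat> X Y z n \<le> gromov_norm UNIV X Y z n"
  unfolding gromov_norm_eq[of UNIV]
proof (rule cInf_greatest)
  have "z n \<in> jchains UNIV X Y" using z by (auto simp: jchains_def)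
  then show "l1 ` representatives UNIV X Y (z n) \<noteq> {}" using representatives_self by blast
  fix x assume "x \<in> l1 ` representatives UNIV X Y (z n)"
  then obtain c where c: "c \<in> representatives UNIV X Y (z n)" "x = l1 c" by blast
  show "gromov_norm \<rat> X Y z n \<le> x"
    unfolding c(2)
  proof (rule field_le_epsilon)
    fix e :: real assume "e > 0"
    from representatives_UNIV_approx[OF z c(1) this]
    obtain c' where "c' \<in> representatives \<rat> X Y (z n)" "l1 c' \<le> l1 c + e" by blast
    then show "gromov_norm \<rat> X Y z n \<le> l1 c + e"
      using gromov_norm_le[of c' \<rat> X Y z n] by simp
  qed
qed

section \<open>Reduction to finitely many diagrams\<close>

text \<open>
  Names of edges are arbitrary natural numbers, so already isomorphic copies of one diagram form an
  infinite set. As \<open>jdegree\<close> rounds down, a diagram of degree \<open>n\<close> has at most \<open>2 n + 1\<close> vertices, hence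
  at most \<open>6 n + 3\<close> ends of edges, and that many names suffice.
\<close>

definition small_jdiags :: "strand list \<Rightarrow> nat set \<Rightarrow> nat \<Rightarrow> jdiag set" where
  "small_jdiags X Y n = {D \<in> jdiags X Y. jdegree D = n \<and> set (edge_ends D) \<subseteq> {..<6 * n + 3}}"

lemma length_edge_ends: "length (edge_ends D) = 3 * length (verts D) + legs_no D"
proof -
  have "length (concat (map (\<lambda>(a, b, c). [a, b, c]) vs)) = 3 * length vs" for vs :: "('a \<times> 'a \<times> 'a) list"
    by (induction vs) auto
  then show ?thesis by (simp add: edge_ends_def legs_no_def)
qed

lemma finite_small_jdiags:
  assumes "finite Y"
  shows "finite (small_jdiags X Y n)"
proof -
  let ?A = "{..<6 * n + 3}" and ?m = "2 * n + 1"
  let ?V = "{vs. set vs \<subseteq> ?A \<times> ?A \<times> ?A \<and> length vs \<le> ?m}"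
  let ?W = "{ws. set ws \<subseteq> ?A \<and> length ws \<le> ?m}"
  let ?C = "{cs. set cs \<subseteq> set X \<times> ?W \<and> length cs \<le> length X}"
  let ?L = "{ls. set ls \<subseteq> Y \<times> ?A \<and> length ls \<le> ?m}"
  have "small_jdiags X Y n \<subseteq> (\<lambda>(vs, cs, ls). JD vs cs ls) ` (?V \<times> ?C \<times> ?L)"
  proof
    fix D assume D: "D \<in> small_jdiags X Y n"
    obtain vs cs ls where D_eq: "D = JD vs cs ls" by (cases D)
    have deg: "length vs + length (concat (map snd cs)) + length ls \<le> ?m"
      using D unfolding D_eq small_jdiags_def jdegree_def legs_no_def by auto
    have ends: "set (edge_ends (JD vs cs ls)) \<subseteq> ?A" using D by (auto simp: small_jdiags_def D_eq)
    have X: "map fst cs = X" "fst ` set ls \<subseteq> Y"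
      using D by (auto simp: small_jdiags_def D_eq jdiags_def)
    have "{x, y, w} \<subseteq> ?A" if "(x, y, w) \<in> set vs" for x y w
      using that by (intro order_trans[OF _ ends]) (force simp: edge_ends_JD)
    then have "vs \<in> ?V" using deg by auto
    moreover have "ls \<in> ?L" using deg ends X(2) by (auto simp: edge_ends_JD image_subset_iff)
    moreover have "cs \<in> ?C"
    proof -
      have "k \<in> set X \<and> ws \<in> ?W" if kw: "(k, ws) \<in> set cs" for k ws
      proof -
        have "k \<in> set X" using kw X(1) by force
        moreover have "set ws \<subseteq> ?A"
          using kw by (intro order_trans[OF _ ends]) (force simp: edge_ends_JD)
        moreover have "length ws \<le> length (concat (map snd cs))"
          using kw by (induction cs) auto
        ultimately show ?thesis using deg by simp
      qed
      moreover have "length cs \<le> length X" using X(1) by auto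
      ultimately show ?thesis by auto
    qed
    ultimately show "D \<in> (\<lambda>(vs, cs, ls). JD vs cs ls) ` (?V \<times> ?C \<times> ?L)"
      unfolding D_eq by (intro image_eqI[of _ _ "(vs, cs, ls)"]) simp_all
  qed
  moreover have "finite (?V \<times> ?C \<times> ?L)"
    using assms by (intro finite_cartesian_product finite_lists_length_le) auto
  ultimately show ?thesis by (meson finite_imageI finite_subset)
qed

lemma edge_ends_map_jgraph: "edge_ends (map_jgraph f D) = map f (edge_ends D)"
  by (cases D) (auto simp: edge_ends_def map_concat intro!: arg_cong[where f = concat])

lemma map_jgraph_in_jdiags:
  assumes "inj f" "D \<in> jdiags X Y"
  shows "map_jgraph f D \<in> jdiags X Y"
proof -
  have "map fst (comps (map_jgraph f D)) = map fst (comps D)" by (simp add: jgraph.map_sel o_def)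
  moreover have "fst ` set (labs (map_jgraph f D)) = fst ` set (labs D)"
    by (simp add: jgraph.map_sel image_image)
  ultimately show ?thesis
    using assms unfolding jdiags_def by (auto simp: edge_ends_map_jgraph count_list_map_conv)
qed

lemma jiso_map_jgraph: "inj f \<Longrightarrow> jiso D (map_jgraph f D)"
  unfolding jiso_def by (intro exI[of _ f] conjI list_all2_refl) (auto simp: same_legs_def)

lemma ex_small_jdiag:
  assumes D: "D \<in> jdiags X Y" "jdegree D = n"
  shows "\<exists>E \<in> small_jdiags X Y n. jiso D E"
proof -
  let ?E = "set (edge_ends D)"
  have "card ?E \<le> length (edge_ends D)" by (rule card_length)
  also have "\<dots> \<le> 3 * (length (verts D) + legs_no D)" by (simp add: length_edge_ends)
  also have "\<dots> \<le> 6 * n + 3" using D(2) unfolding jdegree_def by presburger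
  finally have "card ?E \<le> card {..<6 * n + 3}" by simp
  then obtain g where g: "inj_on g ?E" "g ` ?E \<subseteq> {..<6 * n + 3}"
    using card_le_inj[of ?E "{..<6 * n + 3}"] by auto
  \<comment> \<open>Isomorphisms rename edges by an injection of all natural numbers; the names that do not occur are
  moved out of the way.\<close>
  define f where "f e = (if e \<in> ?E then g e else 6 * n + 3 + e)" for e
  have "inj f"
  proof (rule injI)
    fix x y assume "f x = f y"
    then show "x = y" using g unfolding f_def
      by (auto split: if_splits dest: inj_onD simp: image_subset_iff)
  qed
  have deg: "jdegree (map_jgraph f D) = jdegree D"
    by (simp add: jdegree_def legs_no_def jgraph.map_sel o_def length_concat)
  have "set (edge_ends (map_jgraph f D)) \<subseteq> {..<6 * n + 3}"
    using g(2) by (auto simp: edge_ends_map_jgraph f_def)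
  then have "map_jgraph f D \<in> small_jdiags X Y n"
    using map_jgraph_in_jdiags[OF \<open>inj f\<close> D(1)] deg D(2) by (simp add: small_jdiags_def)
  then show ?thesis using jiso_map_jgraph[OF \<open>inj f\<close>] by blast
qed

definition degree_part :: "nat \<Rightarrow> chain \<Rightarrow> chain" where
  "degree_part n = linext (\<lambda>D. if jdegree D = n then Poly_Mapping.single D 1 else 0)"

lemma lookup_degree_part:
  "Poly_Mapping.lookup (degree_part n p) D = (if jdegree D = n then Poly_Mapping.lookup p D else 0)"
proof -
  have "Poly_Mapping.lookup (degree_part n p) D =
      (\<Sum>E\<in>Poly_Mapping.keys p. if E = D then (if jdegree D = n then Poly_Mapping.lookup p D else 0) else 0)"
    unfolding degree_part_def linext_def lookup_sum
    by (intro sum.cong) (auto simp: lookup_single when_def)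
  also have "\<dots> = (if jdegree D = n then Poly_Mapping.lookup p D else 0)"
    by (simp add: in_keys_iff)
  finally show ?thesis .
qed

lemma degree_part_homogeneous:
  assumes "Poly_Mapping.keys p \<subseteq> {D. jdegree D = m}"
  shows "degree_part n p = (if m = n then p else 0)"
proof (rule poly_mapping_eqI)
  show "Poly_Mapping.lookup (degree_part n p) D = Poly_Mapping.lookup (if m = n then p else 0) D" for D
    using assms by (cases "Poly_Mapping.lookup p D = 0") (auto simp: lookup_degree_part in_keys_iff)
qed

lemma degree_part_jspan:
  assumes K: "coeff_ring K" and p: "p \<in> jspan K X Y"
  shows "degree_part n p \<in> jspan K X Y"
proof -
  obtain R a where R: "finite R" "R \<subseteq> jrel X Y" "a ` R \<subseteq> K" "p = (\<Sum>r\<in>R. cscale (a r) r)"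
    using p unfolding jspan_iff by blast
  have "degree_part n p = (\<Sum>r\<in>R. cscale (a r) (degree_part n r))"
    unfolding R(4) degree_part_def by (simp add: linext_sum linext_cscale)
  also have "\<dots> \<in> jspan K X Y"
  proof (rule jspan_sum[OF K])
    fix r assume r: "r \<in> R"
    then obtain m where m: "Poly_Mapping.keys r \<subseteq> {D\<in>jdiags X Y. jdegree D = m}"
      using jrel_homogeneous R(2) by blast
    have "degree_part n r = (if m = n then r else 0)"
      using m by (intro degree_part_homogeneous) auto
    then show "cscale (a r) (degree_part n r) \<in> jspan K X Y"
      using r R by (auto intro: jspan_rel jspan_0)
  qed
  finally show ?thesis .
qed

text \<open>
  The other degrees of a representative can be dropped, and its diagrams can be replaced by isomorphic
  ones; neither increases the norm. So the infimum defining the Gromov norm is one over chains on a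
  finite set of diagrams.
\<close>

lemma small_representative:
  assumes K: "coeff_ring K" and hom: "homogeneous n z" and c: "c \<in> representatives K X Y z"
  shows "\<exists>c'\<in>representatives K X Y z. Poly_Mapping.keys c' \<subseteq> small_jdiags X Y n \<and> l1 c' \<le> l1 c"
proof -
  define d where "d = degree_part n c"
  have "degree_part n (z - c) = z - d"
  proof (rule poly_mapping_eqI)
    fix D
    have "Poly_Mapping.lookup z D = 0" if "jdegree D \<noteq> n"
      using hom that unfolding homogeneous_def by (auto simp: in_keys_iff)
    then show "Poly_Mapping.lookup (degree_part n (z - c)) D = Poly_Mapping.lookup (z - d) D"
      by (auto simp: d_def lookup_degree_part lookup_minus)
  qed
  then have zd: "z - d \<in> jspan K X Y"
    using c degree_part_jspan[OF K, of "z - c" X Y n] by (simp add: representatives_def)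
  have dK: "Poly_Mapping.lookup d D \<in> K" for D
    using c coeff_ringD(1)[OF K] by (auto simp: d_def lookup_degree_part representatives_def intro: jchainsD)
  have d1: "l1 d \<le> l1 c"
    by (rule l1_mono) (simp add: d_def lookup_degree_part)
  have dX: "D \<in> jdiags X Y \<and> jdegree D = n" if "D \<in> Poly_Mapping.keys d" for D
    using that c by (auto simp: in_keys_iff d_def lookup_degree_part representatives_def
        intro: jchainsD split: if_splits)
  have "\<forall>D\<in>Poly_Mapping.keys d. \<exists>E. E \<in> small_jdiags X Y n \<and> jiso D E"
    using dX ex_small_jdiag by blast
  then obtain \<rho> where \<rho>: "\<And>D. D \<in> Poly_Mapping.keys d \<Longrightarrow> \<rho> D \<in> small_jdiags X Y n \<and> jiso D (\<rho> D)"
    by metis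
  define c' where "c' = linext (\<lambda>D. Poly_Mapping.single (\<rho> D) 1) d"
  have c'_eq: "c' = (\<Sum>D\<in>Poly_Mapping.keys d. Poly_Mapping.single (\<rho> D) (Poly_Mapping.lookup d D))"
    by (simp add: c'_def linext_def cscale_single)
  have single_chain: "Poly_Mapping.single E a \<in> jchains K X Y" if "a \<in> K" "E \<in> jdiags X Y" for E a
    using that coeff_ringD(1)[OF K] by (intro jchainsI) (auto simp: lookup_single when_def split: if_splits)
  have "c' \<in> jchains K X Y"
    unfolding c'_eq using \<rho> dK by (intro jchains_sum K single_chain) (auto simp: small_jdiags_def)
  moreover have "d - c' \<in> jspan K X Y"
  proof -
    have "d - c' = (\<Sum>D\<in>Poly_Mapping.keys d. cscale (Poly_Mapping.lookup d D)
        (Poly_Mapping.single D 1 - Poly_Mapping.single (\<rho> D) 1))"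
      using chain_eq_sum[of "Poly_Mapping.keys d" d]
      by (simp add: c'_eq cscale_diff_right cscale_single sum_subtractf)
    also have "\<dots> \<in> jspan K X Y"
      using \<rho> dX dK by (intro jspan_sum K jspan_rel jrel.ISO) (auto simp: small_jdiags_def)
    finally show ?thesis .
  qed
  then have "z - c' \<in> jspan K X Y"
    using jspan_add[OF K zd, of "d - c'"] by simp
  moreover have "Poly_Mapping.keys c' \<subseteq> small_jdiags X Y n"
  proof
    fix E assume "E \<in> Poly_Mapping.keys c'"
    then have "(\<Sum>D\<in>Poly_Mapping.keys d. Poly_Mapping.lookup (Poly_Mapping.single (\<rho> D) (Poly_Mapping.lookup d D)) E) \<noteq> 0"
      by (simp add: in_keys_iff c'_eq lookup_sum)
    then obtain D where "D \<in> Poly_Mapping.keys d"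
      "Poly_Mapping.lookup (Poly_Mapping.single (\<rho> D) (Poly_Mapping.lookup d D)) E \<noteq> 0"
      by (meson sum.neutral)
    then show "E \<in> small_jdiags X Y n"
      using \<rho> by (auto simp: lookup_single when_def split: if_splits)
  qed
  moreover have "l1 c' \<le> l1 c"
    using l1_linext[of "\<lambda>D. Poly_Mapping.single (\<rho> D) 1" 1 d] d1 by (simp add: c'_def)
  ultimately show ?thesis by (auto simp: representatives_def)
qed

section \<open>Rationality of the rational Gromov norm\<close>

text \<open>
  By \<open>small_representative\<close> the infimum runs over an affine space of rational-valued functions on
  a finite set, and by \<open>l1_minimum_attained\<close>, applied over the field of rational numbers, it is attained there.
\<close>

theorem gromov_norm_rational:
  assumes Y: "finite Y" and z: "z n \<in> jchains \<rat> X Y" and hom: "homogeneous n (z n)"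
  shows "gromov_norm \<rat> X Y z n \<in> \<rat>"
proof -
  let ?F = "small_jdiags X Y n" and ?R = "representatives \<rat> X Y (z n)"
  define emb :: "(jdiag \<Rightarrow> rat) \<Rightarrow> chain"
    where "emb f = (\<Sum>D\<in>?F. Poly_Mapping.single D (of_rat (f D)))" for f
  have F: "finite ?F" by (rule finite_small_jdiags[OF Y])
  have lookup_emb: "Poly_Mapping.lookup (emb f) D = (if D \<in> ?F then of_rat (f D) else 0)" for f D
    using F by (simp add: emb_def lookup_sum lookup_single when_def)
  have l1_emb: "l1 (emb f) = real_of_rat (\<Sum>D\<in>?F. \<bar>f D\<bar>)" for f
  proof -
    have "l1 (emb f) = (\<Sum>D\<in>?F. norm (Poly_Mapping.lookup (emb f) D))"
      using F by (intro l1_superset) (auto simp: in_keys_iff lookup_emb split: if_splits)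
    also have "\<dots> = (\<Sum>D\<in>?F. real_of_rat \<bar>f D\<bar>)"
      by (intro sum.cong) (simp_all add: lookup_emb complex_of_rat_eq)
    finally show ?thesis by (simp add: of_rat_sum)
  qed
  define S where "S = {f. (\<forall>D. D \<notin> ?F \<longrightarrow> f D = 0) \<and> emb f \<in> ?R}"
  have to_S: "\<exists>f\<in>S. l1 (emb f) \<le> l1 c" if c: "c \<in> ?R" for c
  proof -
    obtain c' where c': "c' \<in> ?R" "Poly_Mapping.keys c' \<subseteq> ?F" "l1 c' \<le> l1 c"
      using small_representative[OF coeff_ring_Rats hom c] by blast
    have "\<forall>D. \<exists>q. Poly_Mapping.lookup c' D = of_rat q"
      using c'(1) by (auto simp: representatives_def elim!: Rats_cases dest!: jchainsD(1))
    then obtain g where g: "\<And>D. Poly_Mapping.lookup c' D = of_rat (g D)" by metis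
    have g0: "g D = 0" if "D \<notin> ?F" for D
      using that c'(2) g[of D] by (metis in_keys_iff of_rat_eq_0_iff subsetD)
    have "emb g = c'" using g0 by (intro poly_mapping_eqI) (auto simp: lookup_emb g)
    then show ?thesis using c' g0 by (intro bexI[of _ g]) (auto simp: S_def)
  qed
  have "S \<noteq> {}" using to_S[OF representatives_self[OF z]] by blast
  have affine: "(\<lambda>D. h D + t * (f D - g D)) \<in> S" if S: "f \<in> S" "g \<in> S" "h \<in> S" for f g h t
  proof -
    have jc: "emb f \<in> jchains \<rat> X Y" "emb g \<in> jchains \<rat> X Y" "emb h \<in> jchains \<rat> X Y"
      and js: "z n - emb f \<in> jspan \<rat> X Y" "z n - emb g \<in> jspan \<rat> X Y" "z n - emb h \<in> jspan \<rat> X Y"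
      using S by (auto simp: S_def representatives_def)
    have eq: "emb (\<lambda>D. h D + t * (f D - g D)) = emb h + cscale (of_rat t) (emb f - emb g)"
      by (rule poly_mapping_eqI)
         (simp add: lookup_emb lookup_add lookup_minus of_rat_add of_rat_mult of_rat_diff)
    have "z n - emb (\<lambda>D. h D + t * (f D - g D))
        = (z n - emb h) + cscale (of_rat t) ((z n - emb f) - (z n - emb g))"
      unfolding eq by (rule poly_mapping_eqI) (simp add: lookup_add lookup_minus algebra_simps)
    also have "\<dots> \<in> jspan \<rat> X Y"
      using jspan_diff[OF coeff_ring_Rats js(1,2)]
      by (intro jspan_add[OF _ js(3)] jspan_cscale coeff_ring_Rats) auto
    finally have "emb (\<lambda>D. h D + t * (f D - g D)) \<in> ?R"
      unfolding representatives_def eq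
      using jc by (auto intro!: jchains_add jchains_cscale jchains_diff coeff_ring_Rats)
    then show ?thesis using S by (auto simp: S_def)
  qed
  have "\<exists>f\<in>S. \<forall>g\<in>S. (\<Sum>D\<in>?F. \<bar>f D\<bar>) \<le> (\<Sum>D\<in>?F. \<bar>g D\<bar>)"
    using F _ affine \<open>S \<noteq> {}\<close> by (rule l1_minimum_attained) (auto simp: S_def)
  then obtain f where f: "f \<in> S" "\<And>g. g \<in> S \<Longrightarrow> l1 (emb f) \<le> l1 (emb g)"
    unfolding l1_emb of_rat_less_eq by blast
  have "gromov_norm \<rat> X Y z n = l1 (emb f)"
    unfolding gromov_norm_eq
  proof (rule cInf_eq_minimum)
    show "l1 (emb f) \<in> l1 ` ?R" using f(1) by (simp add: S_def)
    fix x assume "x \<in> l1 ` ?R"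
    then show "l1 (emb f) \<le> x" using to_S f(2) by (force intro: order_trans)
  qed
  then show ?thesis by (simp add: l1_emb)
qed

section \<open>Convergence of the Gromov norm of the Kontsevich integral\<close>

theorem theorem4:
  fixes m :: nat and L :: "curves \<times> curves" and s z :: "nat \<Rightarrow> chain"
  assumes "framed_link m L"
    and "s = sqrt_nu_stack \<or> s = sqrt_nu_union"
    and "kontsevich_integral s m L z"
  shows "gevrey 0 (gromov_norm UNIV (circles m) {} z)
    \<and> conv_radius (gromov_norm UNIV (circles m) {} z) > 0
    \<and> ((\<forall>n. z n \<in> jchains \<rat> (circles m) {}) \<longrightarrow>
        (\<forall>n. gromov_norm \<rat> (circles m) {} z n \<in> \<rat>)
        \<and> gevrey 0 (gromov_norm \<rat> (circles m) {} z)
        \<and> conv_radius (gromov_norm \<rat> (circles m) {} z) > 0)"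
proof -
  let ?X = "circles m"
  let ?N = "\<lambda>K. gromov_norm K ?X {} z"
  obtain T where z: "\<And>n. z n \<in> jchains UNIV ?X {}" and hom: "\<And>n. homogeneous n (z n)"
    and T: "\<And>n. z n - kontsevich s T n \<in> jspan UNIV ?X {}"
    using assms(3) unfolding kontsevich_integral_def by blast
  have "geom_bounded_series s"
    using assms(2) geom_bounded_sqrt_nu_stack geom_bounded_sqrt_nu_union by blast
  then have bound: "geom_bounded_series (kontsevich s T)" by (rule geom_bounded_kontsevich)
  have le: "\<bar>?N UNIV n\<bar> \<le> l1 (kontsevich s T n)" for n
  proof -
    \<comment> \<open>The terms of \<open>kontsevich s T n\<close> are diagrams on \<open>m\<close> circles because \<open>z n\<close> and all relations are
    made of such diagrams.\<close>
    have "z n - (z n - kontsevich s T n) \<in> jchains UNIV ?X {}"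
      by (rule jchains_diff[OF coeff_ring_UNIV z jspan_jchains[OF coeff_ring_UNIV T]])
    then have "kontsevich s T n \<in> representatives UNIV ?X {} (z n)"
      using T by (simp add: representatives_def)
    then show ?thesis using gromov_norm_le gromov_norm_nonneg[OF z] by fastforce
  qed
  have UNIV: "geom_bounded (\<lambda>n. \<bar>?N UNIV n\<bar>)" using bound le by (rule geom_bounded_mono)
  have "(\<forall>n. ?N \<rat> n \<in> \<rat>) \<and> gevrey 0 (?N \<rat>) \<and> conv_radius (?N \<rat>) > 0"
    if rat: "\<forall>n. z n \<in> jchains \<rat> ?X {}"
  proof -
    have "\<bar>?N \<rat> n\<bar> \<le> \<bar>?N UNIV n\<bar>" for n
      using gromov_norm_Rats_le gromov_norm_nonneg rat z by (metis abs_of_nonneg)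
    with UNIV have "geom_bounded (\<lambda>n. \<bar>?N \<rat> n\<bar>)" by (rule geom_bounded_mono)
    then show ?thesis
      using gevrey_0_of_geom_bounded gromov_norm_rational rat hom by blast
  qed
  then show ?thesis using gevrey_0_of_geom_bounded[OF UNIV] by blast
qed

end
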